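(* Let $k$ be a positive integer, $\mathbf{x}^{\pm}=(x_1,x_1^{-1},\dots,x_k,x_k^{-1})$ and $\mathbf{y}=(y_1,\dots,y_k)$. Then $$\sum_{\ell(\lambda)\le k}s_\lambda(\mathbf{x}^{\pm})\,s_\lambda(\mathbf{y})=\prod_{i,j=1}^{k}(1-x_jy_i)^{-1}(1-x_j^{-1}y_i)^{-1}=\sum_{\ell(\lambda)\le k}\mathrm{sp}_\lambda(\mathbf{x}^{\pm})\,\mathrm{ss}_\lambda(\mathbf{y}),$$ where both sums are over all partitions $\lambda$ with at most $k$ rows (identities of formal power series in $y_1,\dots,y_k$ with coefficients Laurent polynomials in $x_1,\dots,x_k$).
   Context: Partitions are identified with Young diagrams in English notation; $\ell(\lambda)$ is the number of rows. $[\overline{k}]=\{1,\overline1,\dots,k,\overline k\}$ with the order $1<\overline1<2<\overline2<\cdots<k<\overline k$, and $x_{\overline j}:=x_j^{-1}$. Schur polynomials: $s_\lambda(\mathbf{y})=\sum_T\prod_{m,n}y_{T(m,n)}$ over semistandard Young tableaux $T$ of shape $\lambda$ with entries in $\{1,\dots,k\}$ (rows weakly increasing, columns strictly increasing; $T(m,n)$ is the entry in row $m$, column $n$), and $s_\lambda(\mathbf{x}^{\pm})=\sum_T\prod_{m,n}x_{T(m,n)}$ over semistandard tableaux of shape $\lambda$ with entries in $[\overline k]$, i.e. the Schur polynomial in the $2k$ variables $x_1,x_1^{-1},\dots,x_k,x_k^{-1}$. Symplectic Schur function: a King tableau of shape $\lambda$ is a semistandard filling $T$ of $\lambda$ by $[\overline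 k]$ such that all entries in row $i$ are $\ge i$ for every $i$; $\mathrm{KT}_k(\lambda)$ is the set of these, and $\mathrm{sp}_\lambda(\mathbf{x}^{\pm})=\sum_{T\in\mathrm{KT}_k(\lambda)}\prod_{m,n}x_{T(m,n)}$. SSOT function: a skew shape is a horizontal strip if it contains at most one box in each column. A $k$-semistandard oscillating tableau ($k$-SSOT) of final shape $\lambda$ is a finite sequence of partitions $S=(S^{1},S'^{2},S^{2},S'^{3},\dots,S'^{k},S^{k})$ such that, with $S'^{1}=\emptyset$: $S^{i}\supseteq S'^{i+1}$ and $S^i\setminus S'^{i+1}$ is a (possibly empty) horizontal strip for $1\le i\le k-1$; $S'^{i}\subseteq S^{i}$ and $S^i\setminus S'^i$ is a (possibly empty) horizontal strip for $1\le i\le k$; and $S^k=\lambda$. $\mathrm{SSOT}_k(\lambda)$ is the set of these. Step $i$ consists of deleting the boxes of $S^{i-1}\setminus S'^{i}$ (for $i\ge2$) and then adding the boxes of $S^i\setminus S'^i$. $S$ is identified with the multiset-valued tableau in which $i$ is recorded at a position $(l,m)$ once for each time that box is added or deleted in step $i$; $S(l,m)$ denotes the multiset at $(l,m)$. The weight is $\mathbf{y}^S=\prod_{l,m}\prod_{j\in S(l,m)}y_j$ (so the exponent of $y_i$ is the total number of boxes deleted and added in step $i$), and $\mathrm{ss}_\lambda(\mathbf{y})=\sum_{S\in\mathrm{SSOT}_k(\lambda)}\mathbf{y}^S$, a formal power series. *)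

theory Defs
  imports
    "HOL-Analysis.Infinite_Sum"
    "HOL-Library.Poly_Mapping"
    "HOL-Library.Multiset"
    "HOL-Library.FuncSet"
begin

section \<open>Multivariate formal power series\<close>

text \<open>
  Formal power series in the variables \<open>y\<^sub>0, y\<^sub>1, y\<^sub>2, \<dots>\<close>, given by one coefficient for every exponent
  vector. The power series ring in \<open>y\<^sub>1, \<dots>, y\<^sub>k\<close> is the subring of series not involving other
  variables.
\<close>

typedef 'a mvps = "UNIV :: ((nat \<Rightarrow>\<^sub>0 nat) \<Rightarrow> 'a) set"
  morphisms mvps_coeff Abs_mvps
  by simp

setup_lifting type_definition_mvps

lemma mvps_eqI: "(\<And>a. mvps_coeff f a = mvps_coeff g a) \<Longrightarrow> f = g"
  by transfer auto

definition exp_splits :: "(nat \<Rightarrow>\<^sub>0 nat) \<Rightarrow> ((nat \<Rightarrow>\<^sub>0 nat) \<times> (nat \<Rightarrow>\<^sub>0 nat)) set" where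
  "exp_splits a = {(b, c). b + c = a}"

lemma finite_exp_splits: "finite (exp_splits a)"
proof -
  let ?K = "Poly_Mapping.keys a"
  let ?r = "\<lambda>b. restrict (Poly_Mapping.lookup b) ?K"
  let ?B = "{b. \<exists>c. b + c = a}"
  have le: "Poly_Mapping.lookup b i \<le> Poly_Mapping.lookup a i" if "b \<in> ?B" for b i
    using that by (auto simp: lookup_add)
  have "inj_on ?r ?B"
  proof (rule inj_onI)
    fix b b' assume bb: "b \<in> ?B" "b' \<in> ?B" and eq: "?r b = ?r b'"
    show "b = b'"
    proof (rule poly_mapping_eqI)
      fix i
      show "Poly_Mapping.lookup b i = Poly_Mapping.lookup b' i"
      proof (cases "i \<in> ?K")
        case True
        then show ?thesis using fun_cong[OF eq, of i] by simp
      next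
        case False
        then have "Poly_Mapping.lookup a i = 0" by (simp add: in_keys_iff)
        then show ?thesis using le[OF bb(1), of i] le[OF bb(2), of i] by simp
      qed
    qed
  qed
  moreover have "?r ` ?B \<subseteq> PiE ?K (\<lambda>i. {..Poly_Mapping.lookup a i})"
    using le by auto
  moreover have "finite (PiE ?K (\<lambda>i. {..Poly_Mapping.lookup a i}))"
    by (intro finite_PiE) auto
  ultimately have "finite ?B"
    by (meson finite_imageD finite_subset)
  moreover have "exp_splits a \<subseteq> (\<lambda>b. (b, a - b)) ` ?B"
    by (auto simp: exp_splits_def)
  ultimately show ?thesis
    by (meson finite_imageI finite_subset)
qed

instantiation mvps :: (comm_ring_1) comm_ring_1
begin

lift_definition zero_mvps :: "'a mvps" is "\<lambda>_. 0" .
lift_definition one_mvps :: "'a mvps" is "\<lambda>a. if a = 0 then 1 else 0" .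
lift_definition plus_mvps :: "'a mvps \<Rightarrow> 'a mvps \<Rightarrow> 'a mvps" is "\<lambda>f g a. f a + g a" .
lift_definition minus_mvps :: "'a mvps \<Rightarrow> 'a mvps \<Rightarrow> 'a mvps" is "\<lambda>f g a. f a - g a" .
lift_definition uminus_mvps :: "'a mvps \<Rightarrow> 'a mvps" is "\<lambda>f a. - f a" .
lift_definition times_mvps :: "'a mvps \<Rightarrow> 'a mvps \<Rightarrow> 'a mvps" is
  "\<lambda>f g a. \<Sum>(b, c)\<in>exp_splits a. f b * g c" .

instance
proof
  fix f g h :: "'a mvps"
  show "f + g + h = f + (g + h)" "f + g = g + f" "0 + f = f" "- f + f = 0" "f - g = f + - g"
    by (transfer; simp add: fun_eq_iff algebra_simps)+
  show "(0::'a mvps) \<noteq> 1"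
    by transfer (auto simp: fun_eq_iff)
  show "(f + g) * h = f * h + g * h"
    by transfer (simp add: fun_eq_iff distrib_right sum.distrib case_prod_unfold)
  show "f * g = g * f"
  proof (transfer, rule ext)
    fix f g :: "(nat \<Rightarrow>\<^sub>0 nat) \<Rightarrow> 'a" and a
    show "(\<Sum>(b, c)\<in>exp_splits a. f b * g c) = (\<Sum>(b, c)\<in>exp_splits a. g b * f c)"
      by (rule sum.reindex_bij_witness[of _ prod.swap prod.swap])
        (auto simp: exp_splits_def ac_simps)
  qed
  show "1 * f = f"
  proof (transfer, rule ext)
    fix f :: "(nat \<Rightarrow>\<^sub>0 nat) \<Rightarrow> 'a" and a
    have "(\<Sum>(b, c)\<in>exp_splits a. (if b = 0 then 1 else 0) * f c)
        = (\<Sum>(b, c)\<in>{(0 :: nat \<Rightarrow>\<^sub>0 nat, a)}. (if b = 0 then 1 else 0) * f c)"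
      by (rule sum.mono_neutral_right) (auto simp: finite_exp_splits, auto simp: exp_splits_def split: if_splits)
    then show "(\<Sum>(b, c)\<in>exp_splits a. (if b = 0 then 1 else 0) * f c) = f a"
      by simp
  qed
  show "f * g * h = f * (g * h)"
  proof (transfer, rule ext)
    fix f g h :: "(nat \<Rightarrow>\<^sub>0 nat) \<Rightarrow> 'a" and a
    have "(\<Sum>(b, c)\<in>exp_splits a. (\<Sum>(d, e)\<in>exp_splits b. f d * g e) * h c)
        = (\<Sum>p\<in>exp_splits a. \<Sum>q\<in>exp_splits (fst p). f (fst q) * g (snd q) * h (snd p))"
      by (simp add: sum_distrib_right case_prod_unfold)
    also have "\<dots> = (\<Sum>(p, q)\<in>(SIGMA p:exp_splits a. exp_splits (fst p)).
        f (fst q) * g (snd q) * h (snd p))"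
      by (rule sum.Sigma) (auto simp: finite_exp_splits)
    also have "\<dots> = (\<Sum>(p, q)\<in>(SIGMA p:exp_splits a. exp_splits (snd p)).
        f (fst p) * (g (fst q) * h (snd q)))"
      by (rule sum.reindex_bij_witness[of _
            "\<lambda>((d, r), (e, c)). ((d + e, c), (d, e))" "\<lambda>((b, c), (d, e)). ((d, e + c), (e, c))"])
        (auto simp: exp_splits_def ac_simps)
    also have "\<dots> = (\<Sum>p\<in>exp_splits a. \<Sum>q\<in>exp_splits (snd p). f (fst p) * (g (fst q) * h (snd q)))"
      by (rule sum.Sigma [symmetric]) (auto simp: finite_exp_splits)
    also have "\<dots> = (\<Sum>(b, c)\<in>exp_splits a. f b * (\<Sum>(d, e)\<in>exp_splits c. g d * h e))"
      by (simp add: sum_distrib_left case_prod_unfold)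
    finally show "(\<Sum>(b, c)\<in>exp_splits a. (\<Sum>(d, e)\<in>exp_splits b. f d * g e) * h c)
        = (\<Sum>(b, c)\<in>exp_splits a. f b * (\<Sum>(d, e)\<in>exp_splits c. g d * h e))" .
  qed
qed

end

text \<open>The multiplicative inverse where it exists, and the junk value \<open>0\<close> on non-units.\<close>

instantiation mvps :: (comm_ring_1) inverse
begin

definition inverse_mvps :: "'a mvps \<Rightarrow> 'a mvps" where inverse_mvps_def:
  "inverse f = (if \<exists>g::'a mvps. f * g = 1 then THE g. f * g = 1 else 0)"

definition divide_mvps :: "'a mvps \<Rightarrow> 'a mvps \<Rightarrow> 'a mvps" where
  "divide_mvps f g = f * inverse g"

instance ..

end

lemma mvps_inverse_eqI:
  fixes f g :: "'a::comm_ring_1 mvps"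
  assumes "f * g = 1"
  shows "inverse f = g"
proof -
  have "h = g" if "f * h = 1" for h
    using that assms by (metis mult.assoc mult.commute mult_1)
  with assms have "(THE h. f * h = 1) = g"
    by (rule the_equality)
  moreover have "\<exists>h. f * h = 1"
    using assms by (rule exI)
  ultimately show ?thesis
    by (simp only: inverse_mvps_def if_True)
qed

text \<open>
  The product topology for discrete coefficients: a net of power series converges iff each
  coefficient is eventually constant. Infinite sums of power series, taken with \<^const>\<open>HAS_SUM\<close> and
  \<^const>\<open>infsum\<close>, refer to this topology, so that they are the usual coefficientwise formal sums.
\<close>

instantiation mvps :: (comm_ring_1) t2_space
begin

definition open_mvps :: "'a mvps set \<Rightarrow> bool" where
  "open U \<longleftrightarrow> (\<forall>f\<in>U. \<exists>A. finite A \<and> {g. \<forall>a\<in>A. mvps_coeff g a = mvps_coeff f a} \<subseteq> U)"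

instance
proof
  show "open (UNIV :: 'a mvps set)"
    by (auto simp: open_mvps_def)
  show "open (U \<inter> V)" if U: "open U" and V: "open V" for U V :: "'a mvps set"
    unfolding open_mvps_def
  proof
    fix f assume f: "f \<in> U \<inter> V"
    obtain A where A: "finite A" "{g. \<forall>a\<in>A. mvps_coeff g a = mvps_coeff f a} \<subseteq> U"
      using U f unfolding open_mvps_def by blast
    obtain B where B: "finite B" "{g. \<forall>a\<in>B. mvps_coeff g a = mvps_coeff f a} \<subseteq> V"
      using V f unfolding open_mvps_def by blast
    show "\<exists>A. finite A \<and> {g. \<forall>a\<in>A. mvps_coeff g a = mvps_coeff f a} \<subseteq> U \<inter> V"
      using A B by (intro exI[of _ "A \<union> B"]) blast
  qed
  show "open (\<Union>\<U>)" if \<U>: "\<forall>U\<in>\<U>. open U" for \<U> :: "'a mvps set set"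
    unfolding open_mvps_def
  proof
    fix f assume "f \<in> \<Union>\<U>"
    then obtain U where U: "U \<in> \<U>" "f \<in> U" by blast
    with \<U> have "open U" by blast
    with U(2) obtain A where "finite A" "{g. \<forall>a\<in>A. mvps_coeff g a = mvps_coeff f a} \<subseteq> U"
      unfolding open_mvps_def by blast
    then show "\<exists>A. finite A \<and> {g. \<forall>a\<in>A. mvps_coeff g a = mvps_coeff f a} \<subseteq> \<Union>\<U>"
      using U(1) by blast
  qed
  fix f g :: "'a mvps"
  assume "f \<noteq> g"
  then obtain a where a: "mvps_coeff f a \<noteq> mvps_coeff g a"
    using mvps_eqI by blast
  have "open {h :: 'a mvps. mvps_coeff h a = c}" for c
    unfolding open_mvps_def by (auto intro!: exI[of _ "{a}"])
  with a show "\<exists>U V. open U \<and> open V \<and> f \<in> U \<and> g \<in> V \<and> U \<inter> V = {}"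
    by (intro exI[of _ "{h. mvps_coeff h a = mvps_coeff f a}"]
          exI[of _ "{h. mvps_coeff h a = mvps_coeff g a}"]) auto
qed

end

lemma tendsto_mvps_iff:
  fixes f :: "'b \<Rightarrow> 'a::comm_ring_1 mvps"
  shows "(f \<longlongrightarrow> l) F \<longleftrightarrow> (\<forall>a. \<forall>\<^sub>F t in F. mvps_coeff (f t) a = mvps_coeff l a)"
proof (intro iffI allI)
  fix a assume lim: "(f \<longlongrightarrow> l) F"
  have "open {h :: 'a mvps. mvps_coeff h a = mvps_coeff l a}"
    unfolding open_mvps_def by (auto intro!: exI[of _ "{a}"])
  from topological_tendstoD[OF lim this]
  show "\<forall>\<^sub>F t in F. mvps_coeff (f t) a = mvps_coeff l a" by simp
next
  assume ev: "\<forall>a. \<forall>\<^sub>F t in F. mvps_coeff (f t) a = mvps_coeff l a"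
  show "(f \<longlongrightarrow> l) F"
  proof (rule topological_tendstoI)
    fix U :: "'a mvps set" assume "open U" "l \<in> U"
    then obtain A where A: "finite A" "{g. \<forall>a\<in>A. mvps_coeff g a = mvps_coeff l a} \<subseteq> U"
      unfolding open_mvps_def by blast
    have "\<forall>\<^sub>F t in F. \<forall>a\<in>A. mvps_coeff (f t) a = mvps_coeff l a"
      using A(1) ev by (simp add: eventually_ball_finite_distrib)
    then show "\<forall>\<^sub>F t in F. f t \<in> U"
      by eventually_elim (use A(2) in auto)
  qed
qed

lift_definition mvps_const :: "'a::comm_ring_1 \<Rightarrow> 'a mvps" is
  "\<lambda>c a. if a = 0 then c else 0" .

lift_definition mvps_var :: "nat \<Rightarrow> 'a::comm_ring_1 mvps" is
  "\<lambda>i a. if a = Poly_Mapping.single i 1 then 1 else 0" .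


section \<open>Laurent polynomials and the barred alphabet\<close>

text \<open>
  Finitely supported functions from integer exponent vectors to \<open>\<int>\<close>, with the convolution product
  of \<^type>\<open>poly_mapping\<close>: integer Laurent polynomials in \<open>x\<^sub>0, x\<^sub>1, x\<^sub>2, \<dots>\<close>.
\<close>

type_synonym laurent = "(nat \<Rightarrow>\<^sub>0 int) \<Rightarrow>\<^sub>0 int"

datatype letter = Plain nat | Barred nat

fun letter_rank :: "letter \<Rightarrow> nat" where
  "letter_rank (Plain j) = 2 * j"
| "letter_rank (Barred j) = 2 * j + 1"

text \<open>The order \<open>Plain 1 < Barred 1 < Plain 2 < Barred 2 < \<dots>\<close>.\<close>

instantiation letter :: linorder
begin

definition less_eq_letter :: "letter \<Rightarrow> letter \<Rightarrow> bool" where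
  "a \<le> b \<longleftrightarrow> letter_rank a \<le> letter_rank b"

definition less_letter :: "letter \<Rightarrow> letter \<Rightarrow> bool" where
  "a < b \<longleftrightarrow> letter_rank a < letter_rank b"

instance
proof
  fix a b :: letter
  assume "a \<le> b" "b \<le> a"
  then have "letter_rank a = letter_rank b" by (simp add: less_eq_letter_def)
  then show "a = b" by (cases a; cases b) (simp; presburger)+
qed (auto simp: less_eq_letter_def less_letter_def)

end

definition barred_alphabet :: "nat \<Rightarrow> letter set" where
  "barred_alphabet k = Plain ` {1..k} \<union> Barred ` {1..k}"

fun x_var :: "letter \<Rightarrow> laurent" where
  "x_var (Plain j) = Poly_Mapping.single (Poly_Mapping.single j 1) 1"
| "x_var (Barred j) = Poly_Mapping.single (Poly_Mapping.single j (- 1)) 1"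


section \<open>Partitions, tableaux and Schur polynomials\<close>

text \<open>
  Partitions are weakly decreasing lists of positive parts, so \<open>\<ell>(\<lambda>)\<close> is \<^const>\<open>length\<close>. Boxes are pairs
  (row, column), both counted from \<open>1\<close>.
\<close>

type_synonym partition = "nat list"

definition is_partition :: "partition \<Rightarrow> bool" where
  "is_partition la \<longleftrightarrow> sorted_wrt (\<ge>) la \<and> (\<forall>p\<in>set la. p > 0)"

definition diagram :: "partition \<Rightarrow> (nat \<times> nat) set" where
  "diagram la = {(m, n). 1 \<le> m \<and> m \<le> length la \<and> 1 \<le> n \<and> n \<le> la ! (m - 1)}"

text \<open>Fillings are extensional (\<^const>\<open>undefined\<close> outside the diagram), so that distinct functions are
  distinct fillings.\<close>

definition SSYT :: "'l::linorder set \<Rightarrow> partition \<Rightarrow> (nat \<times> nat \<Rightarrow> 'l) set" where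
  "SSYT L la = {T \<in> diagram la \<rightarrow>\<^sub>E L.
     (\<forall>m n n'. (m, n) \<in> diagram la \<and> (m, n') \<in> diagram la \<and> n < n' \<longrightarrow> T (m, n) \<le> T (m, n')) \<and>
     (\<forall>m m' n. (m, n) \<in> diagram la \<and> (m', n) \<in> diagram la \<and> m < m' \<longrightarrow> T (m, n) < T (m', n))}"

definition schur :: "'l::linorder set \<Rightarrow> ('l \<Rightarrow> 'a::comm_ring_1) \<Rightarrow> partition \<Rightarrow> 'a" where
  "schur L v la = (\<Sum>T\<in>SSYT L la. \<Prod>b\<in>diagram la. v (T b))"

definition KT :: "nat \<Rightarrow> partition \<Rightarrow> (nat \<times> nat \<Rightarrow> letter) set" where
  "KT k la = {T \<in> SSYT (barred_alphabet k) la. \<forall>(m, n)\<in>diagram la. Plain m \<le> T (m, n)}"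

definition sp :: "nat \<Rightarrow> (letter \<Rightarrow> 'a::comm_ring_1) \<Rightarrow> partition \<Rightarrow> 'a" where
  "sp k v la = (\<Sum>T\<in>KT k la. \<Prod>b\<in>diagram la. v (T b))"


section \<open>Semistandard oscillating tableaux\<close>

definition horizontal_strip :: "partition \<Rightarrow> partition \<Rightarrow> bool" where
  "horizontal_strip la mu \<longleftrightarrow> diagram mu \<subseteq> diagram la \<and>
     (\<forall>m m' n. (m, n) \<in> diagram la - diagram mu \<and> (m', n) \<in> diagram la - diagram mu \<longrightarrow> m = m')"

text \<open>
  An oscillating tableau is encoded as the list of pairs \<open>[(S'\<^sup>1, S\<^sup>1), \<dots>, (S'\<^sup>k, S\<^sup>k)]\<close>, including the
  redundant \<open>S'\<^sup>1 = \<emptyset>\<close>. Steps are counted from \<open>1\<close>.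
\<close>

type_synonym osc = "(partition \<times> partition) list"

definition inner_shape :: "osc \<Rightarrow> nat \<Rightarrow> partition" where
  "inner_shape S i = fst (S ! (i - 1))"

definition outer_shape :: "osc \<Rightarrow> nat \<Rightarrow> partition" where
  "outer_shape S i = snd (S ! (i - 1))"

definition SSOT :: "nat \<Rightarrow> partition \<Rightarrow> osc set" where
  "SSOT k la = {S. length S = k \<and>
     (\<forall>i\<in>{1..k}. is_partition (inner_shape S i) \<and> is_partition (outer_shape S i)) \<and>
     inner_shape S 1 = [] \<and>
     (\<forall>i\<in>{1..k-1}. horizontal_strip (outer_shape S i) (inner_shape S (i + 1))) \<and>
     (\<forall>i\<in>{1..k}. horizontal_strip (outer_shape S i) (inner_shape S i)) \<and>
     outer_shape S k = la}"

definition deleted_boxes :: "osc \<Rightarrow> nat \<Rightarrow> (nat \<times> nat) set" where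
  "deleted_boxes S i =
     (if i \<ge> 2 then diagram (outer_shape S (i - 1)) - diagram (inner_shape S i) else {})"

definition added_boxes :: "osc \<Rightarrow> nat \<Rightarrow> (nat \<times> nat) set" where
  "added_boxes S i = diagram (outer_shape S i) - diagram (inner_shape S i)"

definition osc_entries :: "osc \<Rightarrow> nat \<times> nat \<Rightarrow> nat multiset" where
  "osc_entries S b =
     mset_set {i \<in> {1..length S}. b \<in> deleted_boxes S i} +
     mset_set {i \<in> {1..length S}. b \<in> added_boxes S i}"

text \<open>The product ranges over the boxes that ever occur; all other positions have no entries.\<close>

definition osc_weight :: "osc \<Rightarrow> 'a::comm_ring_1 mvps" where
  "osc_weight S =
     (\<Prod>b\<in>(\<Union>i\<in>{1..length S}. diagram (outer_shape S i)). \<Prod>j\<in>#osc_entries S b. mvps_var j)"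

definition ss :: "nat \<Rightarrow> partition \<Rightarrow> 'a::comm_ring_1 mvps" where
  "ss k la = infsum osc_weight (SSOT k la)"

end

theory Submission
  imports Defs "HOL-Computational_Algebra.Formal_Power_Series"
begin

text \<open>
  The functions \<open>s\<^sub>\<lambda>(x\<^sup>\<plusminus>)\<close> and \<open>sp\<^sub>\<lambda>(x\<^sup>\<plusminus>)\<close> obey Pieri rules. Multiplying \<open>s\<^sub>\<lambda>\<close> by
  \<open>H(y) = \<Prod>\<^sub>j (1 - x\<^sub>j y)\<^sup>-\<^sup>1 (1 - y / x\<^sub>j)\<^sup>-\<^sup>1\<close> adds horizontal strips, with \<open>y\<close> counting boxes; multiplying
  \<open>sp\<^sub>\<lambda>\<close> by \<open>H(y)\<close> removes a horizontal strip and then adds one, provided that all shapes have at most \<open>k\<close>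
  rows. Iterating from the empty shape with \<open>y\<^sub>1, \<dots>, y\<^sub>k\<close> yields both expansions: the walks are semistandard
  tableaux in the first case and oscillating tableaux in the second, and a shape gains at most
  one row per step, so the bound on the rows is harmless.

  Both Pieri rules come by induction over the alphabet from the branching rules, which remove the boxes
  containing the largest letter. What is needed are commutation relations between adding and removing
  horizontal strips. Since \<open>a / b\<close> is a horizontal strip iff the rows of \<open>a\<close> and \<open>b\<close> interlace, the shapes in
  the middle of such a product have rows running independently through intervals, and the relations
  follow by reversing these intervals. A bound on the number of rows spoils the relations by terms on the last
  row; these cancel because of \<open>x\<^sub>j \<cdot> x\<^sub>j\<^sup>-\<^sup>1 = 1\<close>.
\<close>

text \<open>The operators act on tables of values: \<open>s a\<close> is the value of the Schur or
  King function of shape \<open>a\<close>, and a Pieri rule says that such a table is an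
  eigenvector. Removing strips is a finite sum, so \<open>strip_down\<close> may be weighted by any
  ring element; adding them is not, so \<open>strip_up\<close> yields a power series. Hence a letter
  (\<open>fps_const x\<close>) and the variable y (\<open>fps_X\<close>) drive the same kind of
  removal, and \<open>strip_down fps_X (strip_up s)\<close> is the oscillating step: remove first,
  then add. The row bound cannot be ignored for King functions: they vanish beyond k + 1 rows when
  there are k + 1 pairs of letters, whereas the unrestricted branching formula
  \<open>strip_down z (strip_down x s)\<close> reaches k + 2 rows. One-variable rules suffice. The
  product side consists of copies of one series h, one copy for each y_i, so its coefficient at an
  exponent vector e is the product of the \<open>h $ e i\<close>; and the coefficients of
  s_\<lambda>(y) and ss_\<lambda>(y) at e count walks whose i-th step involves \<open>e i\<close>
  boxes.\<close>

unbundle fps_syntax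

section \<open>Shapes as row functions and interlacing\<close>

definition interlace :: "(nat \<Rightarrow> nat) \<Rightarrow> (nat \<Rightarrow> nat) \<Rightarrow> bool" where
  "interlace a b \<longleftrightarrow> (\<forall>i. b i \<le> a i \<and> a (Suc i) \<le> b i)"

text \<open>Row functions are total, with rows counted from 0, so the interlacing inequalities need
  no special case at the end; by monotonicity \<open>a k = 0\<close> bounds the number of rows by
  k.\<close>

definition shapes :: "nat \<Rightarrow> (nat \<Rightarrow> nat) set" where
  "shapes k = {a. antimono a \<and> a k = 0}"

definition shape :: "(nat \<Rightarrow> nat) \<Rightarrow> bool" where
  "shape a \<longleftrightarrow> (\<exists>k. a \<in> shapes k)"

text \<open>For infinite support the index set is infinite and the sum takes the default value 0,
  whence the \<open>shape\<close> hypotheses of lemmas about box counts.\<close>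

definition boxes :: "(nat \<Rightarrow> nat) \<Rightarrow> nat" where
  "boxes a = (\<Sum>i | a i \<noteq> 0. a i)"

lemma shapes_zero: "a \<in> shapes k \<Longrightarrow> k \<le> i \<Longrightarrow> a i = 0"
  using antimonoD[of a k i] by (auto simp: shapes_def)

lemma shapes_mono: "k \<le> l \<Longrightarrow> shapes k \<subseteq> shapes l"
  using shapes_zero by (auto simp: shapes_def)

lemma shapes_shape: "a \<in> shapes k \<Longrightarrow> shape a"
  by (auto simp: shape_def)

lemma boxes_eq_sum: "(\<And>i. i \<ge> k \<Longrightarrow> a i = 0) \<Longrightarrow> boxes a = (\<Sum>i<k. a i)"
  unfolding boxes_def by (rule sum.mono_neutral_left) (auto intro: ccontr simp: not_less)

lemma boxes_shapes: "a \<in> shapes k \<Longrightarrow> boxes a = (\<Sum>i<k. a i)"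
  using boxes_eq_sum shapes_zero by blast

lemma zero_in_shapes: "(\<lambda>_. 0) \<in> shapes k"
  by (simp add: shapes_def antimono_def)

lemma boxes_zero [simp]: "boxes (\<lambda>_. 0) = 0"
  by (simp add: boxes_def)

lemma shapes_0_iff: "a \<in> shapes 0 \<longleftrightarrow> a = (\<lambda>_. 0)"
  using shapes_zero[of a 0] zero_in_shapes[of 0] by auto

lemma interlace_antimono:
  assumes "interlace a b"
  shows "antimono a" "antimono b"
proof -
  have "a (Suc i) \<le> a i \<and> b (Suc i) \<le> b i" for i
    using assms unfolding interlace_def by (meson le_trans)
  then show "antimono a" "antimono b" by (auto simp: antimono_iff_le_Suc)
qed

lemma interlace_shapes_lower: "interlace a b \<Longrightarrow> a \<in> shapes k \<Longrightarrow> b \<in> shapes k"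
  using interlace_antimono[of a b] by (auto simp: interlace_def shapes_def dest: spec[of _ k])

lemma interlace_shapes_upper: "interlace a b \<Longrightarrow> b \<in> shapes k \<Longrightarrow> a \<in> shapes (Suc k)"
  using interlace_antimono[of a b] by (auto simp: interlace_def shapes_def dest: spec[of _ k])

lemma interlace_shape: "interlace a b \<Longrightarrow> shape a \<longleftrightarrow> shape b"
  unfolding shape_def using interlace_shapes_lower interlace_shapes_upper by blast

lemma interlace_boxes_le: "interlace a b \<Longrightarrow> shape a \<Longrightarrow> boxes b \<le> boxes a"
  unfolding shape_def
  by (metis boxes_shapes interlace_def interlace_shapes_lower sum_mono)

text \<open>With at most n boxes no row is longer than n and at most n rows are nonempty, so
  finitely many bounded values determine the shape.\<close>

lemma finite_shapes_bounded: "finite {a. shape a \<and> boxes a \<le> n}"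
proof -
  have "a \<in> (\<lambda>f i. if i < Suc n then f i else 0) ` ({..<Suc n} \<rightarrow>\<^sub>E {..n})"
    if a: "shape a" "boxes a \<le> n" for a
  proof -
    obtain k where k: "a \<in> shapes k" using a by (auto simp: shape_def)
    have b: "a i \<le> n" for i
    proof (cases "i < k")
      case True
      then have "a i \<le> (\<Sum>i<k. a i)" by (intro member_le_sum) auto
      then show ?thesis using a boxes_shapes[OF k] by simp
    qed (use shapes_zero[OF k, of i] in auto)
    have z: "a i = 0" if "Suc n \<le> i" for i
    proof (rule ccontr)
      assume nz: "a i \<noteq> 0"
      then have ik: "i < k" using shapes_zero[OF k, of i] by (cases "i < k") auto
      have "a j \<ge> 1" if "j \<le> i" for j
        using k nz antimonoD[of a j i] that by (auto simp: shapes_def Suc_le_eq)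
      then have "(\<Sum>j\<le>i. 1) \<le> (\<Sum>j\<le>i. a j)" by (intro sum_mono) auto
      also have "\<dots> \<le> (\<Sum>j<k. a j)" using ik by (intro sum_mono2) auto
      finally show False using a boxes_shapes[OF k] that by simp
    qed
    have "a = (\<lambda>f i. if i < Suc n then f i else 0) (restrict a {..<Suc n})"
      using z by (auto simp: fun_eq_iff)
    moreover have "restrict a {..<Suc n} \<in> {..<Suc n} \<rightarrow>\<^sub>E {..n}"
      using b by (auto simp: restrict_def split: if_splits)
    ultimately show ?thesis by (rule image_eqI)
  qed
  then have "{a. shape a \<and> boxes a \<le> n} \<subseteq> (\<lambda>f i. if i < Suc n then f i else 0) ` ({..<Suc n} \<rightarrow>\<^sub>E {..n})"
    by blast
  moreover have "finite ({..<Suc n} \<rightarrow>\<^sub>E {..n})"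
    by (intro finite_PiE) auto
  ultimately show ?thesis by (meson finite_imageI finite_subset)
qed

lemma finite_interlace_lower: "shape a \<Longrightarrow> finite {b. interlace a b}"
  by (rule finite_subset[OF _ finite_shapes_bounded[of "boxes a"]])
    (use interlace_boxes_le interlace_shape in auto)

lemma finite_interlace_upper: "shape a \<Longrightarrow> finite {b. interlace b a \<and> boxes b = n}"
  by (rule finite_subset[OF _ finite_shapes_bounded[of n]]) (auto simp: interlace_shape)

section \<open>Row intervals\<close>

definition interval_box :: "nat \<Rightarrow> (nat \<Rightarrow> nat) \<Rightarrow> (nat \<Rightarrow> nat) \<Rightarrow> (nat \<Rightarrow> nat) set" where
  "interval_box k l u = {c. (\<forall>i<k. l i \<le> c i \<and> c i \<le> u i) \<and> (\<forall>i\<ge>k. c i = 0)}"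

text \<open>Reflecting every coordinate in its interval, \<open>c i\<close> to
  \<open>l i + u i - c i\<close>, is an involution of the box; a point and its image together have
  as many boxes as all interval ends.\<close>

lemma sum_interval_box_reverse:
  fixes F :: "nat \<Rightarrow> 'r::comm_monoid_add"
  shows "(\<Sum>c\<in>interval_box k l u. F (boxes c)) = (\<Sum>c\<in>interval_box k l u. F ((\<Sum>i<k. l i + u i) - boxes c))"
proof -
  let ?r = "\<lambda>c i. if i < k then l i + u i - c i else 0"
  have bx: "boxes c = (\<Sum>i<k. c i)" if "c \<in> interval_box k l u" for c
    using that by (intro boxes_eq_sum) (auto simp: interval_box_def)
  have r: "?r c \<in> interval_box k l u" if "c \<in> interval_box k l u" for c
    using that by (auto simp: interval_box_def)
  have "boxes c = (\<Sum>i<k. l i + u i) - boxes (?r c)" if "c \<in> interval_box k l u" for c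
  proof -
    have "(\<Sum>i<k. l i + u i) = (\<Sum>i<k. c i + ?r c i)"
      using that by (intro sum.cong) (force simp: interval_box_def)+
    then show ?thesis using bx[OF that] bx[OF r[OF that]] by (simp only: sum.distrib)
  qed
  then show ?thesis
    by (intro sum.reindex_bij_witness[of _ ?r ?r])
       (use r in \<open>auto simp: interval_box_def fun_eq_iff\<close>)
qed

lemma interval_box_last_nonzero:
  "l k = 0 \<Longrightarrow> interval_box (Suc k) l u \<inter> {c. c k \<noteq> 0} = interval_box (Suc k) (l(k := 1)) u"
  by (auto simp: interval_box_def less_Suc_eq Suc_le_eq)

text \<open>The four interlacing inequalities constrain each row of \<open>c\<close> separately. Row
  0 gets no upper bound from \<open>b\<close>, hence the case distinction.\<close>

lemma between_eq_interval_box: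
  assumes "a \<in> shapes k" "b \<in> shapes k"
  shows "{c. interlace a c \<and> interlace c b} =
    interval_box k (\<lambda>i. max (a (Suc i)) (b i)) (\<lambda>i. if i = 0 then a 0 else min (a i) (b (i - 1)))"
proof (intro set_eqI iffI; (unfold mem_Collect_eq)?)
  fix c assume c: "interlace a c \<and> interlace c b"
  have "c i \<le> b (i - 1)" if "i \<noteq> 0" for i
    using c that unfolding interlace_def by (cases i) auto
  moreover have "c i = 0" if "i \<ge> k" for i
    using c that interlace_shapes_lower assms(1) shapes_zero by blast
  ultimately show "c \<in> interval_box k (\<lambda>i. max (a (Suc i)) (b i)) (\<lambda>i. if i = 0 then a 0 else min (a i) (b (i - 1)))"
    using c by (auto simp: interval_box_def interlace_def)
next
  fix c assume c: "c \<in> interval_box k (\<lambda>i. max (a (Suc i)) (b i)) (\<lambda>i. if i = 0 then a 0 else min (a i) (b (i - 1)))"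
  note z = shapes_zero[OF assms(1)] shapes_zero[OF assms(2)]
  have "c i \<le> a i \<and> a (Suc i) \<le> c i \<and> b i \<le> c i" for i
    using c z[of i] z[of "Suc i"] by (cases "i < k") (auto simp: interval_box_def split: if_splits)
  moreover have "c (Suc i) \<le> b i" for i
    using c z by (cases "Suc i < k") (force simp: interval_box_def split: if_splits)+
  ultimately show "interlace a c \<and> interlace c b" by (auto simp: interlace_def)
qed

text \<open>The lower end of row i and the upper end of row i + 1 are the max and the min of the
  same two numbers, \<open>a (Suc i)\<close> and \<open>b i\<close>, so the sum telescopes; the
  leftover min at row k vanishes because \<open>a k = 0\<close>.\<close>

lemma sum_interval_ends:
  assumes "a \<in> shapes k" "b \<in> shapes k"
  shows "(\<Sum>i<k. max (a (Suc i)) (b i) + (if i = 0 then a 0 else min (a i) (b (i - 1)))) = boxes a + boxes b"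
proof (cases k)
  case 0
  then show ?thesis using assms boxes_shapes[of _ 0] by simp
next
  case (Suc k')
  have s: "(\<Sum>i<m. max (a (Suc i)) (b i) + (if i = 0 then a 0 else min (a i) (b (i - 1))))
      + min (a m) (b (m - 1)) = (\<Sum>i<Suc m. a i) + (\<Sum>i<m. b i)" if "m \<ge> 1" for m
    using that
  proof (induction m rule: nat_induct_at_least)
    case base
    then show ?case by simp
  next
    case (Suc m)
    then show ?case by (simp add: max_def min_def split: if_splits)
  qed
  have "a k = 0" using assms by (simp add: shapes_def)
  then show ?thesis using s[of k] Suc boxes_shapes[OF assms(1)] boxes_shapes[OF assms(2)] by simp
qed

section \<open>Removing and adding horizontal strips\<close>

definition strip_down :: "'r::comm_ring_1 \<Rightarrow> ((nat \<Rightarrow> nat) \<Rightarrow> 'r) \<Rightarrow> (nat \<Rightarrow> nat) \<Rightarrow> 'r" where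
  "strip_down q f a = (\<Sum>b | interlace a b. q ^ (boxes a - boxes b) * f b)"

definition strip_up :: "((nat \<Rightarrow> nat) \<Rightarrow> 'r::comm_ring_1) \<Rightarrow> (nat \<Rightarrow> nat) \<Rightarrow> 'r fps" where
  "strip_up f a = Abs_fps (\<lambda>n. \<Sum>b | interlace b a \<and> boxes b = boxes a + n. f b)"

lemma strip_down_cong:
  "(\<And>b. interlace a b \<Longrightarrow> f b = g b) \<Longrightarrow> strip_down q f a = strip_down q g a"
  unfolding strip_down_def by (intro sum.cong) auto

lemma strip_up_cong:
  "(\<And>b. interlace b a \<Longrightarrow> f b = g b) \<Longrightarrow> strip_up f a = strip_up g a"
  unfolding strip_up_def by (intro arg_cong[where f = Abs_fps] ext sum.cong) auto

lemma strip_down_diff: "strip_down q (\<lambda>b. f b - g b) a = strip_down q f a - strip_down q g a"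
  by (simp add: strip_down_def right_diff_distrib sum_subtractf)

lemma strip_down_mult: "strip_down q (\<lambda>b. c * f b) a = c * strip_down q f a"
  by (simp add: strip_down_def sum_distrib_left ac_simps)

lemma strip_down_fps_const:
  "strip_down (fps_const q) (\<lambda>b. fps_const (f b)) a = fps_const (strip_down q f a)"
  by (simp add: fps_eq_iff strip_down_def fps_sum_nth sum.neutral)

text \<open>Sorting by the bottom shape \<open>b\<close> turns commutation into an identity between
  sums over the middle shapes alone, as the range of \<open>b\<close> does not depend on p and q.
  Later \<open>P\<close> is \<open>True\<close> or says that the middle shape occupies row
  k.\<close>

lemma strip_down_twice:
  assumes "shape a"
  shows "strip_down p (\<lambda>c. if P c then strip_down q f c else 0) a =
    (\<Sum>b | shape b \<and> boxes b \<le> boxes a.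
      (\<Sum>c | interlace a c \<and> interlace c b \<and> P c. p ^ (boxes a - boxes c) * q ^ (boxes c - boxes b)) * f b)"
proof -
  let ?B = "{b. shape b \<and> boxes b \<le> boxes a}"
  have sub: "shape b \<and> boxes b \<le> boxes a" if "interlace a c" "interlace c b" for b c
    using that assms interlace_shape interlace_boxes_le le_trans by blast
  have "strip_down p (\<lambda>c. if P c then strip_down q f c else 0) a =
      (\<Sum>c | interlace a c. \<Sum>b | b \<in> ?B \<and> (interlace c b \<and> P c).
        p ^ (boxes a - boxes c) * q ^ (boxes c - boxes b) * f b)"
    unfolding strip_down_def
  proof (intro sum.cong refl)
    fix c assume "c \<in> {b. interlace a b}"
    then have "{b. b \<in> ?B \<and> (interlace c b \<and> P c)} = (if P c then {b. interlace c b} else {})"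
      using sub by auto
    then show "p ^ (boxes a - boxes c) * (if P c then \<Sum>b | interlace c b. q ^ (boxes c - boxes b) * f b else 0) =
      (\<Sum>b | b \<in> ?B \<and> (interlace c b \<and> P c). p ^ (boxes a - boxes c) * q ^ (boxes c - boxes b) * f b)"
      by (simp add: sum_distrib_left mult.assoc)
  qed
  also have "\<dots> = (\<Sum>b\<in>?B. \<Sum>c | c \<in> {c. interlace a c} \<and> (interlace c b \<and> P c).
        p ^ (boxes a - boxes c) * q ^ (boxes c - boxes b) * f b)"
    by (rule sum.swap_restrict) (use assms finite_interlace_lower finite_shapes_bounded in auto)
  finally show ?thesis by (simp add: sum_distrib_right)
qed

text \<open>By \<open>sum_interval_ends\<close>, reversal replaces \<open>boxes c\<close> by
  \<open>boxes a + boxes b - boxes c\<close>, which interchanges the exponents of p and q.\<close>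

lemma between_sum_commute:
  fixes p q :: "'r::comm_ring_1"
  assumes "shape a"
  shows "(\<Sum>c | interlace a c \<and> interlace c b. p ^ (boxes a - boxes c) * q ^ (boxes c - boxes b)) =
    (\<Sum>c | interlace a c \<and> interlace c b. q ^ (boxes a - boxes c) * p ^ (boxes c - boxes b))"
proof (cases "{c. interlace a c \<and> interlace c b} = {}")
  case False
  obtain k where a: "a \<in> shapes k" using assms by (auto simp: shape_def)
  with False have b: "b \<in> shapes k" using interlace_shapes_lower by blast
  note box = between_eq_interval_box[OF a b]
  have "(boxes a - (boxes a + boxes b - boxes c)) = boxes c - boxes b"
       "(boxes a + boxes b - boxes c) - boxes b = boxes a - boxes c"
    if "interlace a c \<and> interlace c b" for c
    using that interlace_boxes_le[of a c] interlace_boxes_le[of c b] assms interlace_shape[of a c] by auto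
  then show ?thesis
    unfolding box
    by (subst sum_interval_box_reverse, unfold sum_interval_ends[OF a b], intro sum.cong)
       (auto simp: box[symmetric] mult.commute)
qed (simp only: sum.empty)

lemma strip_down_commute:
  assumes "shape a"
  shows "strip_down p (strip_down q f) a = strip_down q (strip_down p f) a"
  using strip_down_twice[OF assms, where p = p and q = q and f = f and P = "\<lambda>_. True"]
    strip_down_twice[OF assms, where p = q and q = p and f = f and P = "\<lambda>_. True"]
    between_sum_commute[OF assms, where p = p and q = q] by simp

text \<open>Compared with the previous reversal, the interval of the last row (with index \<open>k\<close>) is shortened
  from \<open>[0, m]\<close> to \<open>[1, m]\<close>, whence the extra factors.\<close>

lemma between_sum_commute_last_row:
  fixes p q :: "'r::comm_ring_1"
  assumes a: "a \<in> shapes (Suc k)" and b: "b \<in> shapes k"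
  shows "p * (\<Sum>c | interlace a c \<and> interlace c b \<and> c k \<noteq> 0. p ^ (boxes a - boxes c) * q ^ (boxes c - boxes b)) =
    q * (\<Sum>c | interlace a c \<and> interlace c b \<and> c k \<noteq> 0. q ^ (boxes a - boxes c) * p ^ (boxes c - boxes b))"
proof -
  have b': "b \<in> shapes (Suc k)" using b shapes_mono[of k "Suc k"] by auto
  let ?l = "\<lambda>i. max (a (Suc i)) (b i)" and ?u = "\<lambda>i. if i = 0 then a 0 else min (a i) (b (i - 1))"
  let ?l' = "?l(k := 1)"
  have box: "{c. interlace a c \<and> interlace c b} = interval_box (Suc k) ?l ?u"
    by (rule between_eq_interval_box[OF a b'])
  have lk: "?l k = 0" using shapes_zero[OF a] shapes_zero[OF b] by auto
  have "{c. interlace a c \<and> interlace c b \<and> c k \<noteq> 0} = {c. interlace a c \<and> interlace c b} \<inter> {c. c k \<noteq> 0}"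
    by auto
  also have "\<dots> = interval_box (Suc k) ?l' ?u"
    unfolding box using lk by (rule interval_box_last_nonzero)
  finally have box': "{c. interlace a c \<and> interlace c b \<and> c k \<noteq> 0} = interval_box (Suc k) ?l' ?u" .
  have "(\<Sum>i<Suc k. ?l' i + ?u i) = (\<Sum>i<Suc k. ?l i + ?u i) + 1"
    using lk by simp
  then have ends: "(\<Sum>i<Suc k. ?l' i + ?u i) = boxes a + boxes b + 1"
    using sum_interval_ends[OF a b'] by simp
  have *: "p * (p ^ (boxes a - (boxes a + boxes b + 1 - boxes c)) * q ^ (boxes a + boxes b + 1 - boxes c - boxes b)) =
     q * (q ^ (boxes a - boxes c) * p ^ (boxes c - boxes b))"
    if c: "interlace a c \<and> interlace c b \<and> c k \<noteq> 0" for c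
  proof -
    have sa: "shape a" "shape c" using a c shapes_shape interlace_shape by blast+
    have ca: "boxes c \<le> boxes a" using c sa interlace_boxes_le by blast
    have cs: "c \<in> shapes (Suc k)" using c a interlace_shapes_lower by blast
    \<comment> \<open>\<open>b\<close> ends before row k while \<open>c k\<close> is positive, so
      \<open>c\<close> is strictly larger. This keeps the exponent
      \<open>boxes c - boxes b - 1\<close> from being truncated.\<close>
    have "(\<Sum>i<k. b i) \<le> (\<Sum>i<k. c i)" using c by (intro sum_mono) (auto simp: interlace_def)
    then have bc: "boxes b < boxes c" using boxes_shapes[OF cs] boxes_shapes[OF b] c by simp
    have "boxes a - (boxes a + boxes b + 1 - boxes c) = boxes c - boxes b - 1"
      "boxes a + boxes b + 1 - boxes c - boxes b = Suc (boxes a - boxes c)"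
      using ca bc by auto
    then show ?thesis using bc by (simp flip: power_Suc add: Suc_diff_Suc ac_simps)
      (metis Suc_diff_Suc ab_semigroup_mult_class.mult_ac(1) mult.left_commute power_Suc)
  qed
  show ?thesis
    unfolding box' sum_distrib_left
    by (subst sum_interval_box_reverse, unfold ends, intro sum.cong refl *) (unfold box'[symmetric], simp)
qed

text \<open>The shortened interval of row k presupposes a bottom shape without row k, which the
  support of \<open>f\<close> guarantees. It is used with \<open>fps_X\<close> and
  \<open>fps_const x\<close> for p and q.\<close>

lemma strip_down_commute_last_row:
  fixes p q :: "'r::comm_ring_1"
  assumes a: "a \<in> shapes (Suc k)" and f: "\<And>b. b \<notin> shapes k \<Longrightarrow> f b = 0"
  shows "p * strip_down p (\<lambda>c. if c k \<noteq> 0 then strip_down q f c else 0) a =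
    q * strip_down q (\<lambda>c. if c k \<noteq> 0 then strip_down p f c else 0) a"
  unfolding strip_down_twice[OF shapes_shape[OF a]] sum_distrib_left
proof (intro sum.cong refl)
  fix b
  show "p * ((\<Sum>c | interlace a c \<and> interlace c b \<and> c k \<noteq> 0. p ^ (boxes a - boxes c) * q ^ (boxes c - boxes b)) * f b) =
    q * ((\<Sum>c | interlace a c \<and> interlace c b \<and> c k \<noteq> 0. q ^ (boxes a - boxes c) * p ^ (boxes c - boxes b)) * f b)"
    using between_sum_commute_last_row[OF a, of b p q] f[of b]
    by (cases "b \<in> shapes k") (simp_all flip: mult.assoc)
qed

section \<open>Exchanging additions and removals\<close>

text \<open>The growth rule: rows \<open>1, \<dots>, k\<close> of \<open>v\<close> and rows \<open>0, \<dots>, k - 1\<close> of \<open>r\<close> run through the same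
  intervals, which are traversed in opposite directions. What is left are the first row of \<open>v\<close>, which
  is determined by the number of boxes, and the last row of \<open>r\<close>, which is fixed.\<close>

lemma growth_bij:
  assumes a: "a \<in> shapes (Suc k)" and b: "b \<in> shapes (Suc k)"
  shows "bij_betw (\<lambda>v i. if i < k then max (a (Suc i)) (b (Suc i)) + min (a i) (b i) - v (Suc i)
        else if i = k then min (a k) (b k) else 0)
     {v. interlace v a \<and> interlace v b \<and> v \<in> shapes (Suc k) \<and> boxes v = boxes a + n}
     {r. interlace a r \<and> interlace b r \<and> r k = min (a k) (b k) \<and> boxes b \<le> boxes r + n}"
    (is "bij_betw ?f ?V ?R")
proof -
  \<comment> \<open>The inverse map reflects rows 1 to k back; row 0 is what the box count demands,
    and \<open>boxes b \<le> boxes r + n\<close> makes it at least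
    \<open>max (a 0) (b 0)\<close>.\<close>
  let ?g = "\<lambda>r i. if i = 0 then max (a 0) (b 0) + n + boxes r - boxes b
    else if i \<le> k then max (a i) (b i) + min (a (i - 1)) (b (i - 1)) - r (i - 1) else 0"
  have za: "a i = 0" if "Suc k \<le> i" for i using shapes_zero[OF a that] .
  have zb: "b i = 0" if "Suc k \<le> i" for i using shapes_zero[OF b that] .
  have ma: "a (Suc i) \<le> a i" for i using a by (auto simp: shapes_def antimono_iff_le_Suc)
  have mb: "b (Suc i) \<le> b i" for i using b by (auto simp: shapes_def antimono_iff_le_Suc)
  have boxes_ab: "boxes a = (\<Sum>i<Suc k. a i)" "boxes b = (\<Sum>i<Suc k. b i)"
    using boxes_shapes a b by blast+
  \<comment> \<open>Each row i occurs once in a max and once in a min, which add up to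
    \<open>a i + b i\<close>.\<close>
  have ends: "(\<Sum>i<k. max (a (Suc i)) (b (Suc i)) + min (a i) (b i)) + max (a 0) (b 0) + min (a k) (b k)
      = boxes a + boxes b"
  proof -
    have "(\<Sum>i<m. max (a (Suc i)) (b (Suc i)) + min (a i) (b i)) + max (a 0) (b 0) + min (a m) (b m)
      = (\<Sum>i<Suc m. a i) + (\<Sum>i<Suc m. b i)" for m
      by (induction m) (auto simp: max_def min_def)
    then show ?thesis using boxes_ab by simp
  qed
  have f: "?f v \<in> ?R \<and> ?g (?f v) = v" if v: "v \<in> ?V" for v
  proof -
    have vi: "a i \<le> v i" "v (Suc i) \<le> a i" "b i \<le> v i" "v (Suc i) \<le> b i" for i
      using v by (auto simp: interlace_def)
    have zv: "v i = 0" if "Suc k \<le> i" for i using v shapes_zero that by blast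
    have fa: "?f v i \<le> a i \<and> a (Suc i) \<le> ?f v i \<and> ?f v i \<le> b i \<and> b (Suc i) \<le> ?f v i" for i
      using vi(1)[of "Suc i"] vi(3)[of "Suc i"] vi(2)[of i] vi(4)[of i] ma[of i] mb[of i]
        za[of "Suc i"] zb[of "Suc i"]
      by (auto simp: max_def min_def not_less)
    then have il: "interlace a (?f v)" "interlace b (?f v)" by (auto simp: interlace_def)
    have bf: "boxes (?f v) = (\<Sum>i<Suc k. ?f v i)" by (intro boxes_eq_sum) auto
    have "(\<Sum>i<k. v (Suc i)) + (\<Sum>i<k. ?f v i) = (\<Sum>i<k. max (a (Suc i)) (b (Suc i)) + min (a i) (b i))"
      unfolding sum.distrib[symmetric]
      by (intro sum.cong) (use vi in \<open>auto simp: le_max_iff_disj min_def intro!: le_add_diff_inverse trans_le_add2\<close>)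
    moreover have "boxes v = v 0 + (\<Sum>i<k. v (Suc i))"
      using v boxes_shapes[of v "Suc k"] by (simp add: sum.lessThan_Suc_shift del: sum.lessThan_Suc)
    ultimately have key: "boxes a + boxes b + v 0 = max (a 0) (b 0) + (boxes a + n) + boxes (?f v)"
      using ends bf v by simp
    moreover have "max (a 0) (b 0) \<le> v 0" using vi[of 0] by simp
    ultimately have "boxes b \<le> boxes (?f v) + n" by linarith
    moreover have "?g (?f v) i = v i" for i
    proof (cases i)
      case 0
      then show ?thesis using key by simp
    next
      case (Suc j)
      show ?thesis
        using vi(2)[of j] vi(4)[of j] zv[of "Suc j"] unfolding Suc by (simp add: min_def)
    qed
    ultimately show ?thesis using il by auto
  qed
  have g: "?g r \<in> ?V \<and> ?f (?g r) = r" if r: "r \<in> ?R" for r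
  proof -
    have ri: "r i \<le> a i" "a (Suc i) \<le> r i" "r i \<le> b i" "b (Suc i) \<le> r i" for i
      using r by (auto simp: interlace_def)
    have zr: "r i = 0" if "Suc k \<le> i" for i using ri(1)[of i] za that by simp
    have rn: "boxes b \<le> boxes r + n" and rk: "r k = min (a k) (b k)" using r by auto
    have g0: "a i \<le> ?g r i \<and> b i \<le> ?g r i" for i
    proof (cases i)
      case 0
      have "max (a 0) (b 0) \<le> max (a 0) (b 0) + n + boxes r - boxes b" using rn by linarith
      then show ?thesis unfolding 0 by (simp only: max.bounded_iff simp_thms if_True)
    next
      case (Suc j)
      then show ?thesis using ri(1)[of j] ri(3)[of j] za[of i] zb[of i] by (auto simp: min_def max_def)
    qed
    have g1: "?g r (Suc i) \<le> a i \<and> ?g r (Suc i) \<le> b i" for i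
      using ri(2)[of i] ri(4)[of i] by (auto simp: min_def max_def)
    have il: "interlace (?g r) a" "interlace (?g r) b"
      using g0 g1 by (auto simp: interlace_def)
    then have gs: "?g r \<in> shapes (Suc k)"
      using interlace_antimono(1)[of "?g r" a] by (simp add: shapes_def)
    have "(\<Sum>i<k. ?g r (Suc i)) + (\<Sum>i<k. r i) = (\<Sum>i<k. max (a (Suc i)) (b (Suc i)) + min (a i) (b i))"
      unfolding sum.distrib[symmetric]
      by (intro sum.cong) (use ri in \<open>auto simp: Suc_le_eq trans_le_add2\<close>)
    moreover have "boxes (?g r) = ?g r 0 + (\<Sum>i<k. ?g r (Suc i))"
      using gs boxes_shapes[of "?g r" "Suc k"] by (simp add: sum.lessThan_Suc_shift del: sum.lessThan_Suc)
    moreover have "boxes r = (\<Sum>i<k. r i) + min (a k) (b k)"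
      using boxes_eq_sum[of "Suc k" r] zr rk by simp
    moreover have "?g r 0 + boxes b = max (a 0) (b 0) + n + boxes r" using rn by simp
    ultimately have "boxes (?g r) = boxes a + n"
      using ends by linarith
    moreover have "?f (?g r) = r"
    proof
      fix i show "?f (?g r) i = r i"
        using ri[of i] rk zr[of i] by (auto simp: min_def max_def)
    qed
    ultimately show ?thesis using il gs by auto
  qed
  show ?thesis
    by (rule bij_betw_byWitness[where f' = ?g]) (use f g in \<open>auto simp del: mem_Collect_eq\<close>)
qed

section \<open>The growth rule in terms of generating functions\<close>

definition geometric :: "'r::comm_ring_1 \<Rightarrow> 'r fps" where
  "geometric c = Abs_fps (\<lambda>n. c ^ n)"

lemma geometric_inverse: "(1 - fps_const c * fps_X) * geometric c = 1"
proof (rule fps_ext)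
  fix n
  show "((1 - fps_const c * fps_X) * geometric c) $ n = 1 $ n"
    by (cases n) (simp_all add: geometric_def left_diff_distrib mult.assoc)
qed

text \<open>The left side runs over shapes v above both \<open>a\<close> and a bottom shape
  \<open>b\<close>; \<open>growth_bij\<close> replaces v by r below both. The exponent
  \<open>boxes a + n - boxes b\<close> splits into \<open>boxes a - boxes r\<close> and
  \<open>n - (boxes b - boxes r)\<close>, the latter feeding a geometric series. The bound of k + 1
  rows on v reappears as the pinned last row of r.\<close>

lemma strip_up_strip_down_coeff:
  fixes g :: "(nat \<Rightarrow> nat) \<Rightarrow> 'r::comm_ring_1"
  assumes a: "a \<in> shapes (Suc k)" and g: "\<And>b. b \<notin> shapes (Suc k) \<Longrightarrow> g b = 0"
  shows "(\<Sum>v | interlace v a \<and> boxes v = boxes a + n. if v \<in> shapes (Suc k) then strip_down z g v else 0) =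
    (\<Sum>r | interlace a r. z ^ (boxes a - boxes r) *
      (\<Sum>b | interlace b r \<and> r k = min (a k) (b k) \<and> boxes b \<le> boxes r + n.
         z ^ (n - (boxes b - boxes r)) * g b))"
proof -
  let ?V = "{v. interlace v a \<and> boxes v = boxes a + n \<and> v \<in> shapes (Suc k)}"
  let ?S = "{b. b \<in> shapes (Suc k) \<and> boxes b \<le> boxes a + n}"
  let ?w = "\<lambda>r b. z ^ (boxes a - boxes r) * (z ^ (n - (boxes b - boxes r)) * g b)"
  have sa: "shape a" using a shapes_shape by blast
  have fV: "finite ?V"
    by (rule finite_subset[OF _ finite_interlace_upper[OF sa, of "boxes a + n"]]) auto
  have fS: "finite ?S"
    by (rule finite_subset[OF _ finite_shapes_bounded[of "boxes a + n"]]) (auto intro: shapes_shape)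
  have "(\<Sum>v | interlace v a \<and> boxes v = boxes a + n. if v \<in> shapes (Suc k) then strip_down z g v else 0)
      = (\<Sum>v\<in>?V. strip_down z g v)"
    by (rule sum.mono_neutral_cong_right) (use finite_interlace_upper[OF sa] in auto)
  also have "\<dots> = (\<Sum>v\<in>?V. \<Sum>b | b \<in> ?S \<and> interlace v b. z ^ (boxes v - boxes b) * g b)"
  proof (intro sum.cong refl)
    fix v assume v: "v \<in> ?V"
    then have sv: "shape v" using shapes_shape by blast
    have "b \<in> ?S" if "interlace v b" for b
      using v that interlace_shapes_lower[OF that] interlace_boxes_le[OF that sv] by auto
    then have "{b. b \<in> ?S \<and> interlace v b} = {b. interlace v b}" by blast
    then show "strip_down z g v = (\<Sum>b | b \<in> ?S \<and> interlace v b. z ^ (boxes v - boxes b) * g b)"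
      by (simp add: strip_down_def)
  qed
  also have "\<dots> = (\<Sum>b\<in>?S. \<Sum>v | v \<in> ?V \<and> interlace v b. z ^ (boxes v - boxes b) * g b)"
    by (rule sum.swap_restrict[OF fV fS])
  also have "\<dots> = (\<Sum>b\<in>?S. \<Sum>r | r \<in> {r. interlace a r} \<and>
      (interlace b r \<and> r k = min (a k) (b k) \<and> boxes b \<le> boxes r + n). ?w r b)"
  proof (rule sum.cong[OF refl])
    fix b assume b: "b \<in> ?S"
    then have b': "b \<in> shapes (Suc k)" by simp
    have w: "z ^ (boxes a + n - boxes b) * g b = ?w r b"
      if "interlace a r \<and> interlace b r \<and> r k = min (a k) (b k) \<and> boxes b \<le> boxes r + n" for r
    proof -
      have "boxes a + n - boxes b = (boxes a - boxes r) + (n - (boxes b - boxes r))"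
        using that interlace_boxes_le[of a r] interlace_boxes_le[of b r] sa shapes_shape[OF b'] by auto
      then show ?thesis by (simp only: power_add mult.assoc)
    qed
    have e: "{v. v \<in> ?V \<and> interlace v b} =
        {v. interlace v a \<and> interlace v b \<and> v \<in> shapes (Suc k) \<and> boxes v = boxes a + n}" by auto
    have "(\<Sum>v | v \<in> ?V \<and> interlace v b. z ^ (boxes v - boxes b) * g b) =
      (\<Sum>v | interlace v a \<and> interlace v b \<and> v \<in> shapes (Suc k) \<and> boxes v = boxes a + n.
         z ^ (boxes a + n - boxes b) * g b)"
      unfolding e by (rule sum.cong) auto
    also have "\<dots> = (\<Sum>r | interlace a r \<and> interlace b r \<and> r k = min (a k) (b k) \<and> boxes b \<le> boxes r + n.
         z ^ (boxes a + n - boxes b) * g b)"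
      by (rule sum.reindex_bij_betw[OF growth_bij[OF a b', of n]])
    also have "\<dots> = (\<Sum>r | r \<in> {r. interlace a r} \<and>
      (interlace b r \<and> r k = min (a k) (b k) \<and> boxes b \<le> boxes r + n). ?w r b)"
      using w by (intro sum.cong) auto
    finally show "(\<Sum>v | v \<in> ?V \<and> interlace v b. z ^ (boxes v - boxes b) * g b) = \<dots>" .
  qed
  also have "\<dots> = (\<Sum>r\<in>{r. interlace a r}. \<Sum>b | b \<in> ?S \<and>
      (interlace b r \<and> r k = min (a k) (b k) \<and> boxes b \<le> boxes r + n). ?w r b)"
    by (rule sum.swap_restrict[symmetric]) (use fS finite_interlace_lower[OF sa] in auto)
  also have "\<dots> = (\<Sum>r | interlace a r. z ^ (boxes a - boxes r) *
      (\<Sum>b | interlace b r \<and> r k = min (a k) (b k) \<and> boxes b \<le> boxes r + n.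
         z ^ (n - (boxes b - boxes r)) * g b))"
  proof (intro sum.cong refl, unfold sum_distrib_left, rule sum.mono_neutral_left)
    fix r assume "r \<in> {r. interlace a r}"
    then have r: "interlace a r" by simp
    then have sr: "shape r" "boxes r \<le> boxes a" using sa interlace_shape interlace_boxes_le by blast+
    show "finite {b. interlace b r \<and> r k = min (a k) (b k) \<and> boxes b \<le> boxes r + n}"
      by (rule finite_subset[OF _ finite_shapes_bounded[of "boxes r + n"]]) (use sr interlace_shape in auto)
    show "\<forall>b\<in>{b. interlace b r \<and> r k = min (a k) (b k) \<and> boxes b \<le> boxes r + n} -
       {b. b \<in> ?S \<and> (interlace b r \<and> r k = min (a k) (b k) \<and> boxes b \<le> boxes r + n)}. ?w r b = 0"
    proof
      fix b assume "b \<in> {b. interlace b r \<and> r k = min (a k) (b k) \<and> boxes b \<le> boxes r + n} -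
        {b. b \<in> ?S \<and> (interlace b r \<and> r k = min (a k) (b k) \<and> boxes b \<le> boxes r + n)}"
      then have "b \<notin> shapes (Suc k)" using sr by auto
      then show "?w r b = 0" by (simp add: g)
    qed
  qed auto
  finally show ?thesis .
qed

text \<open>For \<open>b\<close> of degree j = \<open>d b - m\<close> the power z^(n - j) is the
  complementary coefficient of the geometric series, so grouping by j gives a Cauchy
  product.\<close>

lemma sum_graded_eq_geometric_coeff:
  fixes g :: "'b \<Rightarrow> 'r::comm_ring_1"
  assumes fin: "finite {b. P b \<and> d b \<le> m + n}" and le: "\<And>b. P b \<Longrightarrow> m \<le> d b"
  shows "(\<Sum>b | P b \<and> d b \<le> m + n. z ^ (n - (d b - m)) * g b) =
    (geometric z * Abs_fps (\<lambda>j. \<Sum>b | P b \<and> d b = m + j. g b)) $ n"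
proof -
  have "(geometric z * Abs_fps (\<lambda>j. \<Sum>b | P b \<and> d b = m + j. g b)) $ n =
     (\<Sum>i=0..n. z ^ (n - i) * (\<Sum>b | P b \<and> d b = m + i. g b))"
    unfolding mult.commute[of "geometric z"] fps_mult_nth by (simp add: geometric_def mult.commute)
  also have "\<dots> = (\<Sum>i=0..n. \<Sum>b\<in>{b. b \<in> {b. P b \<and> d b \<le> m + n} \<and> d b - m = i}. z ^ (n - (d b - m)) * g b)"
  proof (intro sum.cong refl)
    fix i assume "i \<in> {0..n}"
    then have "{b. b \<in> {b. P b \<and> d b \<le> m + n} \<and> d b - m = i} = {b. P b \<and> d b = m + i}"
      using le by (auto dest: le)
    then show "z ^ (n - i) * (\<Sum>b | P b \<and> d b = m + i. g b) =
      (\<Sum>b\<in>{b. b \<in> {b. P b \<and> d b \<le> m + n} \<and> d b - m = i}. z ^ (n - (d b - m)) * g b)"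
      by (simp add: sum_distrib_left)
  qed
  also have "\<dots> = (\<Sum>b | P b \<and> d b \<le> m + n. z ^ (n - (d b - m)) * g b)"
    by (rule sum.group[OF fin]) auto
  finally show ?thesis ..
qed

lemma boxes_update_last:
  assumes "r \<in> shapes (Suc k)"
  shows "boxes (r(k := c)) + r k = boxes r + c"
proof -
  have "boxes (r(k := c)) = (\<Sum>i<Suc k. (r(k := c)) i)"
    by (rule boxes_eq_sum) (use shapes_zero[OF assms] in auto)
  then show ?thesis using boxes_shapes[OF assms] by simp
qed

text \<open>As \<open>a\<close> has no row k + 1, row k of the lower shape is bounded only from
  above.\<close>

lemma interlace_update_last:
  assumes "a \<in> shapes (Suc k)"
  shows "interlace a (r(k := c)) \<longleftrightarrow> c \<le> a k \<and> (\<forall>i. i \<noteq> k \<longrightarrow> r i \<le> a i \<and> a (Suc i) \<le> r i)"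
  using shapes_zero[OF assms, of "Suc k"] by (auto simp: interlace_def)

text \<open>The unpinned pairs to be subtracted satisfy \<open>r k < min (a k) (b k)\<close>. Adding
  one box to row k of \<open>r\<close> maps them onto all pairs with \<open>r k \<noteq> 0\<close>;
  this box accounts for the extra factor z and for the shift of the degree by one.\<close>

lemma sum_fixed_last_row:
  fixes g :: "(nat \<Rightarrow> nat) \<Rightarrow> 'r::comm_ring_1"
  assumes a: "a \<in> shapes (Suc k)" and g: "\<And>b. b \<notin> shapes (Suc k) \<Longrightarrow> g b = 0"
  shows "(\<Sum>r | interlace a r. z ^ (boxes a - boxes r) *
      (\<Sum>b | interlace b r \<and> r k = min (a k) (b k) \<and> boxes b = boxes r + n. g b)) =
    (\<Sum>r | interlace a r. z ^ (boxes a - boxes r) * (\<Sum>b | interlace b r \<and> boxes b = boxes r + n. g b)) -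
    (\<Sum>r | interlace a r \<and> r k \<noteq> 0. z ^ Suc (boxes a - boxes r) *
      (\<Sum>b | interlace b r \<and> Suc (boxes b) = boxes r + n. g b))"
proof -
  let ?w = "\<lambda>(r, b). z ^ (boxes a - boxes r) * g b"
  let ?w' = "\<lambda>(r, b). z ^ Suc (boxes a - boxes r) * g b"
  have sa: "shape a" using a shapes_shape by blast
  have fin: "finite {r. interlace a r}" by (rule finite_interlace_lower[OF sa])
  let ?A = "Sigma {r. interlace a r} (\<lambda>r. {b. interlace b r \<and> boxes b = boxes r + n})"
  let ?A1 = "Sigma {r. interlace a r} (\<lambda>r. {b. interlace b r \<and> r k = min (a k) (b k) \<and> boxes b = boxes r + n})"
  let ?A2 = "{(r, b). interlace a r \<and> interlace b r \<and> r k \<noteq> min (a k) (b k) \<and> boxes b = boxes r + n \<and> b \<in> shapes (Suc k)}"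
  let ?B = "Sigma {r. interlace a r \<and> r k \<noteq> 0} (\<lambda>r. {b. interlace b r \<and> Suc (boxes b) = boxes r + n})"
  let ?B' = "{(r, b). interlace a r \<and> r k \<noteq> 0 \<and> interlace b r \<and> Suc (boxes b) = boxes r + n \<and> b \<in> shapes (Suc k)}"
  have g': "b \<in> shapes (Suc k)" if "x * g b \<noteq> 0" for x b using g that by fastforce
  have sr: "shape r" if "interlace a r" for r using that sa interlace_shape by blast
  have finB: "finite {b. interlace b r \<and> Suc (boxes b) = boxes r + n}" if "interlace a r" for r
    by (rule finite_subset[OF _ finite_shapes_bounded[of "boxes r + n"]]) (use interlace_shape sr[OF that] in auto)
  have finA: "finite ?A" using finite_interlace_upper sr fin by (intro finite_SigmaI) auto
  have finB': "finite ?B" using finB fin by (intro finite_SigmaI) auto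
  have "(\<Sum>r | interlace a r. z ^ (boxes a - boxes r) * (\<Sum>b | interlace b r \<and> boxes b = boxes r + n. g b))
     = sum ?w ?A"
    unfolding sum_distrib_left using fin finite_interlace_upper sr by (subst sum.Sigma) auto
  \<comment> \<open>Unpinned pairs with \<open>b\<close> beyond k + 1 rows are dropped,
    \<open>g\<close> being 0 there: row k of \<open>r\<close> moves freely below \<open>b k\<close>
    only if \<open>b\<close> has no row k + 1.\<close>
  also have "\<dots> = sum ?w (?A1 \<union> ?A2)"
    by (rule sum.mono_neutral_right[OF finA]) (auto dest: g')
  also have "\<dots> = sum ?w ?A1 + sum ?w ?A2"
    by (rule sum.union_disjoint) (auto intro: finite_subset[OF _ finA])
  also have "sum ?w ?A1 = (\<Sum>r | interlace a r. z ^ (boxes a - boxes r) *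
      (\<Sum>b | interlace b r \<and> r k = min (a k) (b k) \<and> boxes b = boxes r + n. g b))"
    unfolding sum_distrib_left
    by (subst sum.Sigma[OF fin]) (auto intro: finite_subset[OF _ finite_interlace_upper[OF sr]])
  also have "sum ?w ?A2 = sum ?w' ?B'"
  proof (rule sum.reindex_bij_witness[of _ "\<lambda>(r, b). (r(k := r k - 1), b)" "\<lambda>(r, b). (r(k := Suc (r k)), b)"])
    fix x assume "x \<in> ?A2"
    then obtain r b where x: "x = (r, b)" and rb: "interlace a r" "interlace b r" "r k \<noteq> min (a k) (b k)"
      "boxes b = boxes r + n" "b \<in> shapes (Suc k)" by auto
    have rs: "r \<in> shapes (Suc k)" using rb a interlace_shapes_lower by blast
    have "r k \<le> a k" "r k \<le> b k" using rb unfolding interlace_def by auto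
    then have lt: "r k < a k" "r k < b k" using rb(3) by linarith+
    have il: "interlace a (r(k := Suc (r k)))" "interlace b (r(k := Suc (r k)))"
      using lt rb(1,2) interlace_update_last[OF a] interlace_update_last[OF rb(5)] by (auto simp: interlace_def)
    have bx: "boxes (r(k := Suc (r k))) = Suc (boxes r)" using boxes_update_last[OF rs, of "Suc (r k)"] by simp
    have "boxes (r(k := Suc (r k))) \<le> boxes a" using il sa interlace_boxes_le by blast
    then show "?w' ((\<lambda>(r, b). (r(k := Suc (r k)), b)) x) = ?w x"
      using bx by (simp add: x Suc_diff_Suc flip: power_Suc)
    show "(\<lambda>(r, b). (r(k := Suc (r k)), b)) x \<in> ?B'" using il bx rb by (simp add: x)
    show "(\<lambda>(r, b). (r(k := r k - 1), b)) ((\<lambda>(r, b). (r(k := Suc (r k)), b)) x) = x" by (simp add: x)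
  next
    fix x assume "x \<in> ?B'"
    then obtain r b where x: "x = (r, b)" and rb: "interlace a r" "interlace b r" "r k \<noteq> 0"
      "Suc (boxes b) = boxes r + n" "b \<in> shapes (Suc k)" by auto
    have rs: "r \<in> shapes (Suc k)" using rb a interlace_shapes_lower by blast
    have le: "r k \<le> a k" "r k \<le> b k" using rb unfolding interlace_def by auto
    then have "r k - 1 \<le> a k" "r k - 1 \<le> b k" by linarith+
    then    have il: "interlace a (r(k := r k - 1))" "interlace b (r(k := r k - 1))"
      using rb(1,2) interlace_update_last[OF a] interlace_update_last[OF rb(5)] by (auto simp: interlace_def)
    have bx: "Suc (boxes (r(k := r k - 1))) = boxes r" using boxes_update_last[OF rs, of "r k - 1"] rb(3) by simp
    show "(\<lambda>(r, b). (r(k := r k - 1), b)) x \<in> ?A2" using il bx rb le by (auto simp: x)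
    show "(\<lambda>(r, b). (r(k := Suc (r k)), b)) ((\<lambda>(r, b). (r(k := r k - 1), b)) x) = x"
      using rb(3) by (simp add: x)
  qed
  also have "sum ?w' ?B' = sum ?w' ?B"
    by (rule sum.mono_neutral_left[OF finB']) (auto dest: g')
  also have "\<dots> = (\<Sum>r | interlace a r \<and> r k \<noteq> 0. z ^ Suc (boxes a - boxes r) *
      (\<Sum>b | interlace b r \<and> Suc (boxes b) = boxes r + n. g b))"
    unfolding sum_distrib_left using fin finB by (subst sum.Sigma) auto
  finally show ?thesis by (simp add: algebra_simps)
qed

text \<open>Grouping by the number of added boxes gives the geometric series, and
  \<open>sum_fixed_last_row\<close> frees the pinned last row at the cost of the correction: at
  shapes with a row k, the factor 1 - z y cancels the geometric series.\<close>

lemma strip_up_strip_down_bounded: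
  fixes g :: "(nat \<Rightarrow> nat) \<Rightarrow> 'r::comm_ring_1"
  assumes a: "a \<in> shapes (Suc k)" and g: "\<And>b. b \<notin> shapes (Suc k) \<Longrightarrow> g b = 0"
  shows "strip_up (\<lambda>v. if v \<in> shapes (Suc k) then strip_down z g v else 0) a =
    geometric z * strip_down (fps_const z)
      (\<lambda>r. strip_up g r - (if r k \<noteq> 0 then fps_const z * fps_X * strip_up g r else 0)) a"
proof -
  have sa: "shape a" using a shapes_shape by blast
  have fin: "finite {r. interlace a r}" by (rule finite_interlace_lower[OF sa])
  let ?U = "\<lambda>r. Abs_fps (\<lambda>j. \<Sum>b | (interlace b r \<and> r k = min (a k) (b k)) \<and> boxes b = boxes r + j. g b)"
  let ?Q = "\<Sum>r | interlace a r. fps_const (z ^ (boxes a - boxes r)) * ?U r"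
  have X: "(fps_X * strip_up g r) $ n = (\<Sum>b | interlace b r \<and> Suc (boxes b) = boxes r + n. g b)"
    if r: "interlace a r" for r n
  proof (cases n)
    case 0
    have "{b. interlace b r \<and> Suc (boxes b) = boxes r} = {}"
      using sa r interlace_shape interlace_boxes_le by (metis (mono_tags, lifting) Suc_n_not_le_n empty_Collect_eq)
    then have "(\<Sum>b | interlace b r \<and> Suc (boxes b) = boxes r. g b) = 0" by (simp only: sum.empty)
    then show ?thesis using 0 by simp
  qed (simp add: strip_up_def)
  have "?Q = strip_down (fps_const z)
      (\<lambda>r. strip_up g r - (if r k \<noteq> 0 then fps_const z * fps_X * strip_up g r else 0)) a"
  proof (rule fps_ext)
    fix n
    have "strip_down (fps_const z) (\<lambda>r. strip_up g r - (if r k \<noteq> 0 then fps_const z * fps_X * strip_up g r else 0)) a $ n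
      = (\<Sum>r | interlace a r. z ^ (boxes a - boxes r) * (\<Sum>b | interlace b r \<and> boxes b = boxes r + n. g b)) -
        (\<Sum>r | interlace a r. if r k \<noteq> 0 then z ^ Suc (boxes a - boxes r) * (fps_X * strip_up g r) $ n else 0)"
      unfolding strip_down_diff strip_down_def fps_sub_nth fps_sum_nth
    proof (intro arg_cong2[where f = "(-)"] sum.cong refl)
      fix r
      show "(fps_const z ^ (boxes a - boxes r) * (if r k \<noteq> 0 then fps_const z * fps_X * strip_up g r else 0)) $ n =
        (if r k \<noteq> 0 then z ^ Suc (boxes a - boxes r) * (fps_X * strip_up g r) $ n else 0)"
        by (cases "r k = 0")
          (simp_all only: fps_const_power mult.assoc fps_mult_left_const_nth power_Suc2 not_not simp_thms if_True if_False mult_zero_right fps_zero_nth)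
    qed (simp_all only: fps_const_power fps_mult_left_const_nth strip_up_def fps_nth_Abs_fps)
    also have "(\<Sum>r | interlace a r. if r k \<noteq> 0 then z ^ Suc (boxes a - boxes r) * (fps_X * strip_up g r) $ n else 0)
      = (\<Sum>r | interlace a r \<and> r k \<noteq> 0. z ^ Suc (boxes a - boxes r) *
      (\<Sum>b | interlace b r \<and> Suc (boxes b) = boxes r + n. g b))"
      by (rule sum.mono_neutral_cong_right) (use fin X in \<open>auto simp del: fps_X_mult_nth\<close>)
    finally show "?Q $ n = strip_down (fps_const z)
      (\<lambda>r. strip_up g r - (if r k \<noteq> 0 then fps_const z * fps_X * strip_up g r else 0)) a $ n"
      using sum_fixed_last_row[OF a g, where z = z and n = n] by (simp add: fps_sum_nth conj_assoc)
  qed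
  moreover have "strip_up (\<lambda>v. if v \<in> shapes (Suc k) then strip_down z g v else 0) a = geometric z * ?Q"
  proof (rule fps_ext)
    fix n
    have "(\<Sum>b | interlace b r \<and> r k = min (a k) (b k) \<and> boxes b \<le> boxes r + n. z ^ (n - (boxes b - boxes r)) * g b)
      = (geometric z * ?U r) $ n" if "interlace a r" for r
    proof -
      have sr: "shape r" using sa that interlace_shape by blast
      have "finite {b. (interlace b r \<and> r k = min (a k) (b k)) \<and> boxes b \<le> boxes r + n}"
        by (rule finite_subset[OF _ finite_shapes_bounded[of "boxes r + n"]]) (use sr interlace_shape in auto)
      from sum_graded_eq_geometric_coeff[OF this, where z = z and g = g] show ?thesis
        using interlace_boxes_le interlace_shape sr by (simp add: conj_assoc)
    qed
    then have "strip_up (\<lambda>v. if v \<in> shapes (Suc k) then strip_down z g v else 0) a $ n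
      = (\<Sum>r | interlace a r. z ^ (boxes a - boxes r) * (geometric z * ?U r) $ n)"
      using strip_up_strip_down_coeff[OF a g, where z = z and n = n] by (simp add: strip_up_def)
    also have "\<dots> = (geometric z * ?Q) $ n"
      by (simp add: sum_distrib_left fps_sum_nth mult.left_commute[of "geometric z"] del: fps_const_power)
    finally show "strip_up (\<lambda>v. if v \<in> shapes (Suc k) then strip_down z g v else 0) a $ n = (geometric z * ?Q) $ n" .
  qed
  ultimately show ?thesis by simp
qed

lemma strip_up_eq_0:
  assumes f: "\<And>b. b \<notin> shapes k \<Longrightarrow> f b = 0" and a: "a \<notin> shapes k"
  shows "strip_up f a = 0"
proof (rule fps_ext)
  fix n
  have "f b = 0" if "interlace b a" for b
    using f a that interlace_shapes_lower by blast
  then show "strip_up f a $ n = 0 $ n" by (simp add: strip_up_def)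
qed

lemma strip_down_eq_0:
  assumes f: "\<And>b. b \<notin> shapes k \<Longrightarrow> f b = 0" and a: "a \<notin> shapes (Suc k)"
  shows "strip_down q f a = 0"
proof -
  have "f b = 0" if "interlace a b" for b
    using f a that interlace_shapes_upper by blast
  then show ?thesis by (simp add: strip_down_def)
qed

text \<open>Above a shape of at most k rows no shape exceeds k + 1 rows, so the bound k + 1 is void;
  below it row k is empty, so the correction vanishes. Truncating \<open>g\<close> to
  \<open>?g\<close> provides the required support.\<close>

lemma strip_up_strip_down:
  fixes g :: "(nat \<Rightarrow> nat) \<Rightarrow> 'r::comm_ring_1"
  assumes a: "shape a"
  shows "strip_up (strip_down z g) a = geometric z * strip_down (fps_const z) (strip_up g) a"
proof -
  obtain k where k: "a \<in> shapes k" using a by (auto simp: shape_def)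
  then have k': "a \<in> shapes (Suc k)" using shapes_mono[of k "Suc k"] by auto
  let ?g = "\<lambda>b. if b \<in> shapes (Suc k) then g b else 0"
  have up: "c \<in> shapes (Suc k)" if "interlace c b" "b \<in> shapes k" for b c
    using that interlace_shapes_upper by blast
  have "strip_up (\<lambda>v. if v \<in> shapes (Suc k) then strip_down z ?g v else 0) a = strip_up (strip_down z g) a"
  proof -
    have "strip_down z ?g v = strip_down z g v" if "interlace v a" for v
      by (rule strip_down_cong) (use up[OF that k] interlace_shapes_lower in auto)
    then show ?thesis using up k by (intro strip_up_cong) simp
  qed
  moreover have "strip_down (fps_const z)
      (\<lambda>r. strip_up ?g r - (if r k \<noteq> 0 then fps_const z * fps_X * strip_up ?g r else 0)) a =
      strip_down (fps_const z) (strip_up g) a"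
  proof (rule strip_down_cong)
    fix r assume "interlace a r"
    then have r: "r \<in> shapes k" using k interlace_shapes_lower by blast
    have "strip_up ?g r = strip_up g r"
      using up r by (intro strip_up_cong) simp
    then show "strip_up ?g r - (if r k \<noteq> 0 then fps_const z * fps_X * strip_up ?g r else 0) = strip_up g r"
      using shapes_zero[OF r, of k] by simp
  qed
  ultimately show ?thesis
    using strip_up_strip_down_bounded[OF k', of ?g z] by simp
qed

section \<open>Pieri rules\<close>

text \<open>The Schur function of the empty alphabet (\<open>tableau_sum_empty\<close>), from which
  both inductions start.\<close>

definition unit_shape :: "(nat \<Rightarrow> nat) \<Rightarrow> 'r::comm_ring_1" where
  "unit_shape a = (if a = (\<lambda>_. 0) then 1 else 0)"

text \<open>The Pieri rule for no variables, with H(y) = 1: the only shape with a nonzero value is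
  the empty one, and it interlaces with no shape below it but itself.\<close>

lemma strip_up_unit_shape: "strip_up (unit_shape :: _ \<Rightarrow> 'r::comm_ring_1) a = fps_const (unit_shape a)"
proof (rule fps_ext)
  fix n
  have "(\<Sum>b | interlace b a \<and> boxes b = boxes a + n. (unit_shape b :: 'r)) =
    (\<Sum>b\<in>(if a = (\<lambda>_. 0) \<and> n = 0 then {\<lambda>_::nat. 0 :: nat} else {}). 1 :: 'r)"
  proof (cases "shape a")
    case True
    have il: "interlace (\<lambda>_. 0) a \<longleftrightarrow> a = (\<lambda>_. 0)" by (auto simp: interlace_def)
    have S: "{b. interlace b a \<and> boxes b = boxes a + n} \<inter> {\<lambda>_. 0} =
        (if a = (\<lambda>_. 0) \<and> n = 0 then {\<lambda>_. 0} else {})"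
      using il by (cases "a = (\<lambda>_. 0)") auto
    show ?thesis
      unfolding S[symmetric]
      by (rule sum.mono_neutral_cong_right[OF finite_interlace_upper[OF True]])
        (simp_all add: unit_shape_def)
  next
    case False
    then have "b \<noteq> (\<lambda>_. 0)" if "interlace b a" for b
      using interlace_shape[OF that] zero_in_shapes by (auto simp: shape_def)
    moreover have "a \<noteq> (\<lambda>_. 0)" using False zero_in_shapes by (auto simp: shape_def)
    ultimately show ?thesis by (auto simp: unit_shape_def intro!: sum.neutral)
  qed
  then show "strip_up unit_shape a $ n = fps_const (unit_shape a :: 'r) $ n"
    by (simp add: strip_up_def unit_shape_def)
qed

text \<open>Exchanging \<open>strip_up\<close> with the removal of the new letter costs one
  geometric factor; what remains is linear, so \<open>h\<close> comes out of the sum.\<close>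

lemma strip_down_pieri:
  assumes "\<And>a. shape a \<Longrightarrow> strip_up s a = h * fps_const (s a)" and "shape a"
  shows "strip_up (strip_down x s) a = geometric x * h * fps_const (strip_down x s a)"
proof -
  have "strip_down (fps_const x) (strip_up s) a = strip_down (fps_const x) (\<lambda>b. h * fps_const (s b)) a"
    by (rule strip_down_cong) (use assms interlace_shape in auto)
  then show ?thesis
    unfolding strip_up_strip_down[OF assms(2)] by (simp add: strip_down_mult strip_down_fps_const mult.assoc)
qed

text \<open>Here \<open>s'\<close> arises from \<open>s\<close> by the King branching rule for the letter \<open>k + 1\<close> and its bar. The
  correction term of \<open>strip_up_strip_down_bounded\<close> turns \<open>strip_down x (strip_down fps_X u)\<close> into its part
  through shapes of at most \<open>k\<close> rows, to which the assumed Pieri rule applies.\<close>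

lemma king_pieri_step:
  fixes s :: "(nat \<Rightarrow> nat) \<Rightarrow> 'r::comm_ring_1"
  assumes xz: "x * z = 1"
    and supp: "\<And>a. a \<notin> shapes k \<Longrightarrow> s a = 0"
    and pieri: "\<And>a. a \<in> shapes k \<Longrightarrow> strip_down fps_X (strip_up s) a = h * fps_const (s a)"
    and s': "\<And>a. s' a = (if a \<in> shapes (Suc k) then strip_down z (strip_down x s) a else 0)"
    and a: "a \<in> shapes (Suc k)"
  shows "strip_down fps_X (strip_up s') a = geometric x * geometric z * h * fps_const (s' a)"
proof -
  let ?x = "fps_const x" and ?z = "fps_const z"
  let ?u = "strip_up s"
  \<comment> \<open>At shapes reaching row k this multiplies by 1 - z y, the correction of
    \<open>strip_up_strip_down_bounded\<close>.\<close>
  let ?w = "\<lambda>r t. t - (if r k \<noteq> 0 then ?z * fps_X * t else 0)"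
  have supp1: "strip_down x s b = 0" if "b \<notin> shapes (Suc k)" for b
    using strip_down_eq_0[OF supp that] .
  have suppu: "?u b = 0" if "b \<notin> shapes k" for b
    using strip_up_eq_0[OF supp that] .
  have lower: "b \<in> shapes (Suc k)" if "interlace c b" "c \<in> shapes (Suc k)" for b c
    using interlace_shapes_lower that .
  have sh: "shape b" if "b \<in> shapes (Suc k)" for b using shapes_shape that .
  have up_s': "strip_up s' b = geometric x * geometric z * strip_down ?z (\<lambda>r. ?w r (strip_down ?x ?u r)) b"
    if b: "b \<in> shapes (Suc k)" for b
  proof -
    \<comment> \<open>The row bound concerns only the outer removal. The inner one obeys the
      unrestricted exchange, since \<open>s\<close> lives on \<open>shapes k\<close> and thus
      \<open>strip_down x s\<close> on \<open>shapes (Suc k)\<close>.\<close>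
    have "strip_up s' b = geometric z * strip_down ?z (\<lambda>r. ?w r (strip_up (strip_down x s) r)) b"
      unfolding s' using strip_up_strip_down_bounded[OF b supp1] by simp
    also have "strip_down ?z (\<lambda>r. ?w r (strip_up (strip_down x s) r)) b
      = strip_down ?z (\<lambda>r. geometric x * ?w r (strip_down ?x ?u r)) b"
    proof (rule strip_down_cong)
      fix r assume "interlace b r"
      then have "shape r" using b sh lower by blast
      then show "?w r (strip_up (strip_down x s) r) = geometric x * ?w r (strip_down ?x ?u r)"
        by (simp add: strip_up_strip_down algebra_simps)
    qed
    finally show ?thesis by (simp add: strip_down_mult ac_simps)
  qed
  have cancel: "strip_down fps_X (\<lambda>r. ?w r (strip_down ?x ?u r)) b = h * fps_const (strip_down x s b)"
    if b: "b \<in> shapes (Suc k)" for b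
  proof -
    let ?E = "\<lambda>p q. strip_down p (\<lambda>r. if r k \<noteq> 0 then strip_down q ?u r else 0) b"
    have "strip_down fps_X (\<lambda>r. ?w r (strip_down ?x ?u r)) b =
      strip_down fps_X (strip_down ?x ?u) b - ?z * (fps_X * ?E fps_X ?x)"
    proof -
      have "strip_down fps_X (\<lambda>r. if r k \<noteq> 0 then ?z * fps_X * strip_down ?x ?u r else 0) b =
        (?z * fps_X) * ?E fps_X ?x"
        by (subst strip_down_mult[symmetric], rule strip_down_cong) simp
      then show ?thesis by (simp only: strip_down_diff mult.assoc)
    qed
    \<comment> \<open>The correction carries the factor z y; exchanging the two removals trades y
      for x, and then z x = 1.\<close>
    also have "fps_X * ?E fps_X ?x = ?x * ?E ?x fps_X"
      by (rule strip_down_commute_last_row[OF b suppu])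
    also have "?z * (?x * ?E ?x fps_X) = ?E ?x fps_X"
      using xz by (simp add: mult.assoc[symmetric] mult.commute)
    also have "strip_down fps_X (strip_down ?x ?u) b = strip_down ?x (strip_down fps_X ?u) b"
      by (rule strip_down_commute[OF sh[OF b]])
    also have "strip_down ?x (strip_down fps_X ?u) b - ?E ?x fps_X =
        strip_down ?x (\<lambda>r. h * fps_const (s r)) b"
      unfolding strip_down_diff[symmetric]
    proof (rule strip_down_cong)
      fix r assume "interlace b r"
      then have r: "r \<in> shapes (Suc k)" using b lower by blast
      then have "r \<in> shapes k \<longleftrightarrow> r k = 0" by (auto simp: shapes_def)
      then show "strip_down fps_X ?u r - (if r k \<noteq> 0 then strip_down fps_X ?u r else 0) = h * fps_const (s r)"
        using pieri[of r] supp[of r] by auto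
    qed
    finally show ?thesis by (simp add: strip_down_mult strip_down_fps_const)
  qed
  have "strip_down fps_X (strip_up s') a =
    strip_down fps_X (\<lambda>b. geometric x * geometric z * strip_down ?z (\<lambda>r. ?w r (strip_down ?x ?u r)) b) a"
    by (rule strip_down_cong) (use up_s' lower a in blast)
  also have "\<dots> = geometric x * geometric z * strip_down fps_X (strip_down ?z (\<lambda>r. ?w r (strip_down ?x ?u r))) a"
    by (simp add: strip_down_mult)
  also have "strip_down fps_X (strip_down ?z (\<lambda>r. ?w r (strip_down ?x ?u r))) a =
    strip_down ?z (strip_down fps_X (\<lambda>r. ?w r (strip_down ?x ?u r))) a"
    by (rule strip_down_commute[OF sh[OF a]])
  also have "\<dots> = strip_down ?z (\<lambda>b. h * fps_const (strip_down x s b)) a"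
    by (rule strip_down_cong) (use cancel lower a in blast)
  also have "\<dots> = h * fps_const (s' a)"
    using a by (simp add: strip_down_mult strip_down_fps_const s')
  finally show ?thesis by (simp add: mult.assoc)
qed

section \<open>Tableaux\<close>

definition young :: "(nat \<Rightarrow> nat) \<Rightarrow> (nat \<times> nat) set" where
  "young a = {(m, n). 1 \<le> m \<and> 1 \<le> n \<and> n \<le> a (m - 1)}"

text \<open>Semistandard tableaux whose entries in row \<open>m\<close> satisfy \<open>Q m\<close>; both \<^const>\<open>SSYT\<close> and \<^const>\<open>KT\<close> are
  of this form.\<close>

definition tableaux :: "'l::linorder set \<Rightarrow> (nat \<Rightarrow> 'l \<Rightarrow> bool) \<Rightarrow> (nat \<Rightarrow> nat) \<Rightarrow> (nat \<times> nat \<Rightarrow> 'l) set" where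
  "tableaux L Q a = {T \<in> young a \<rightarrow>\<^sub>E L.
     (\<forall>m n n'. (m, n) \<in> young a \<and> (m, n') \<in> young a \<and> n < n' \<longrightarrow> T (m, n) \<le> T (m, n')) \<and>
     (\<forall>m m' n. (m, n) \<in> young a \<and> (m', n) \<in> young a \<and> m < m' \<longrightarrow> T (m, n) < T (m', n)) \<and>
     (\<forall>m n. (m, n) \<in> young a \<longrightarrow> Q m (T (m, n)))}"

definition tableau_sum ::
    "'l::linorder set \<Rightarrow> (nat \<Rightarrow> 'l \<Rightarrow> bool) \<Rightarrow> ('l \<Rightarrow> 'r::comm_ring_1) \<Rightarrow> (nat \<Rightarrow> nat) \<Rightarrow> 'r" where
  "tableau_sum L Q v a = (\<Sum>T\<in>tableaux L Q a. \<Prod>b\<in>young a. v (T b))"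

lemma young_eq_Sigma: "a \<in> shapes k \<Longrightarrow> young a = (SIGMA m:{1..k}. {1..a (m - 1)})"
proof -
  assume a: "a \<in> shapes k"
  have "m \<le> k" if "1 \<le> n" "n \<le> a (m - 1)" for m n
    using shapes_zero[OF a, of "m - 1"] that by (cases "k \<le> m - 1") auto
  then show ?thesis by (auto simp: young_def)
qed

lemma finite_young: "shape a \<Longrightarrow> finite (young a)"
  unfolding shape_def by (auto simp: young_eq_Sigma)

lemma card_young: "shape a \<Longrightarrow> card (young a) = boxes a"
proof -
  assume "shape a"
  then obtain k where k: "a \<in> shapes k" by (auto simp: shape_def)
  have "(\<Sum>m = 1..k. a (m - 1)) = (\<Sum>i<k. a i)"
    by (rule sum.reindex_bij_witness[of _ Suc "\<lambda>m. m - 1"]) auto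
  then show ?thesis using k by (simp add: young_eq_Sigma boxes_shapes)
qed

lemma young_mono: "(\<And>i. b i \<le> a i) \<Longrightarrow> young b \<subseteq> young a"
  unfolding young_def using le_trans by blast

lemma young_empty_iff: "young a = {} \<longleftrightarrow> a = (\<lambda>_. 0)"
proof
  assume e: "young a = {}"
  show "a = (\<lambda>_. 0)"
  proof
    fix i
    have "(Suc i, a i) \<notin> young a" using e by simp
    then show "a i = 0" by (simp add: young_def)
  qed
qed (auto simp: young_def)

lemma finite_tableaux: "finite L \<Longrightarrow> shape a \<Longrightarrow> finite (tableaux L Q a)"
  by (rule finite_subset[of _ "young a \<rightarrow>\<^sub>E L"]) (auto simp: tableaux_def intro!: finite_PiE finite_young)

lemma tableau_sum_empty: "tableau_sum {} Q v = unit_shape"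
proof
  fix a :: "nat \<Rightarrow> nat"
  show "tableau_sum {} Q v a = unit_shape a"
  proof (cases "young a = {}")
    case True
    then have "tableaux {} Q a = {\<lambda>_. undefined}" by (auto simp: tableaux_def)
    then show ?thesis using True by (simp add: tableau_sum_def unit_shape_def flip: young_empty_iff)
  next
    case False
    then have "tableaux {} Q a = {}" by (auto simp: tableaux_def PiE_def)
    then show ?thesis using False by (simp add: tableau_sum_def unit_shape_def young_empty_iff)
  qed
qed

lemma down_closed_eq_interval:
  fixes D :: "nat set"
  assumes "finite D" "0 \<notin> D" and down: "\<And>m n. n \<in> D \<Longrightarrow> 1 \<le> m \<Longrightarrow> m \<le> n \<Longrightarrow> m \<in> D"
  shows "D = {1..card D}"
proof (cases "D = {}")
  case False
  define n where "n = Max D"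
  have "n \<in> D" and le: "\<And>m. m \<in> D \<Longrightarrow> m \<le> n" using assms(1) False by (auto simp: n_def)
  then have "D = {1..n}" using down assms(2) by (force simp: Suc_le_eq intro: gr0I)
  then show ?thesis by (metis card_atLeastAtMost diff_Suc_1)
qed simp

text \<open>Branching at the largest letter: rows increase weakly, so its boxes end the rows;
  columns increase strictly, so no column holds two of them and the remaining shape interlaces. The
  row condition for \<open>M\<close> concerns only the rows where it occurs, those with
  \<open>b i < a i\<close>.\<close>

lemma tableau_sum_insert:
  fixes M :: "'l::linorder" and v :: "'l \<Rightarrow> 'r::comm_ring_1"
  assumes fin: "finite L" and M: "\<And>t. t \<in> L \<Longrightarrow> t < M" and a: "shape a"
  shows "tableau_sum (insert M L) Q v a =
    (\<Sum>b | interlace a b \<and> (\<forall>i. b i < a i \<longrightarrow> Q (Suc i) M). v M ^ (boxes a - boxes b) * tableau_sum L Q v b)"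
proof -
  let ?B = "{b. interlace a b \<and> (\<forall>i. b i < a i \<longrightarrow> Q (Suc i) M)}"
  let ?S = "Sigma ?B (tableaux L Q)"
  let ?D = "\<lambda>T i. {n. 1 \<le> n \<and> n \<le> a i \<and> T (Suc i, n) \<noteq> M}"
  let ?sh = "\<lambda>T i. card (?D T i)"
  let ?cut = "\<lambda>T. (?sh T, restrict T (young (?sh T)))"
  let ?ext = "\<lambda>(b, T) p. if p \<in> young b then T p else if p \<in> young a then M else undefined"
  have anti: "antimono a" using a by (auto simp: shape_def shapes_def)
  have finB: "finite ?B" by (rule finite_subset[OF _ finite_interlace_lower[OF a]]) auto
  have cut: "?cut T \<in> ?S \<and> young (?sh T) = {p \<in> young a. T p \<noteq> M} \<and> ?ext (?cut T) = T"
    if T: "T \<in> tableaux (insert M L) Q a" for T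
  proof -
    have TL: "T p \<in> insert M L" if "p \<in> young a" for p using T that by (auto simp: tableaux_def)
    have TM: "T p \<le> M" if "p \<in> young a" for p using TL[OF that] M by (auto intro: less_imp_le)
    have row: "T (m, n) \<le> T (m, n')" if "(m, n) \<in> young a" "(m, n') \<in> young a" "n < n'" for m n n'
      using T that unfolding tableaux_def by blast
    have col: "T (m, n) < T (m', n)" if "(m, n) \<in> young a" "(m', n) \<in> young a" "m < m'" for m m' n
      using T that unfolding tableaux_def by blast
    \<comment> \<open>The columns of a row not holding \<open>M\<close> form an initial segment,
      which justifies counting them to define the row length \<open>?sh T i\<close>.\<close>
    have D: "?D T i = {1..?sh T i}" for i
    proof (rule down_closed_eq_interval)
      fix m n assume n: "n \<in> ?D T i" and m: "1 \<le> m" "m \<le> n"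
      have "T (Suc i, n) < M" using n TM[of "(Suc i, n)"] by (auto simp: young_def less_le)
      moreover have "T (Suc i, m) \<le> T (Suc i, n)"
        using row[of "Suc i" m n] m n by (cases "m = n") (auto simp: young_def)
      ultimately show "m \<in> ?D T i" using n m by auto
    qed auto
    have yb: "young (?sh T) = {p \<in> young a. T p \<noteq> M}"
    proof -
      have "(m, n) \<in> young (?sh T) \<longleftrightarrow> (m, n) \<in> young a \<and> T (m, n) \<noteq> M" for m n
      proof (cases m)
        case (Suc i)
        have "n \<in> ?D T i \<longleftrightarrow> n \<in> {1..?sh T i}" using D[of i] by blast
        then show ?thesis by (auto simp: young_def Suc)
      qed (simp add: young_def)
      then show ?thesis by auto
    qed
    have "a (Suc i) \<le> ?sh T i \<and> ?sh T i \<le> a i" for i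
    proof
      have "card (?D T i) \<le> card {1..a i}" by (rule card_mono) auto
      then show "?sh T i \<le> a i" by simp
      show "a (Suc i) \<le> ?sh T i"
      proof (cases "a (Suc i) = 0")
        case False
        have "a (Suc i) \<le> a i" using anti by (simp add: antimono_iff_le_Suc)
        then have in_a: "(Suc i, a (Suc i)) \<in> young a" "(Suc (Suc i), a (Suc i)) \<in> young a"
          using False by (auto simp: young_def)
        then have "T (Suc i, a (Suc i)) < M" using col[OF in_a] TM[OF in_a(2)] by auto
        then have "a (Suc i) \<in> ?D T i" using in_a by (auto simp: young_def)
        then show ?thesis using D[of i] by (metis (no_types, lifting) atLeastAtMost_iff)
      qed simp
    qed
    then have il: "interlace a (?sh T)" by (simp add: interlace_def)
    have Q: "Q (Suc i) M" if "?sh T i < a i" for i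
    proof -
      have "(Suc i, a i) \<in> young a" "(Suc i, a i) \<notin> young (?sh T)" using that by (auto simp: young_def)
      then have "T (Suc i, a i) = M" "Q (Suc i) (T (Suc i, a i))" using yb T by (auto simp: tableaux_def)
      then show ?thesis by simp
    qed
    define b where "b = ?sh T"
    have yb': "young b = {p \<in> young a. T p \<noteq> M}" using yb unfolding b_def .
    have "restrict T (young b) \<in> tableaux L Q b"
      using T TL unfolding tableaux_def yb' by auto
    moreover have "?ext (b, restrict T (young b)) = T"
      using T unfolding tableaux_def by (auto simp: yb' fun_eq_iff PiE_def extensional_def)
    moreover have "b i < a i \<Longrightarrow> Q (Suc i) M" for i using Q[of i] unfolding b_def .
    then have "b \<in> ?B" using il unfolding b_def[symmetric] by auto
    ultimately show ?thesis using yb' unfolding b_def[symmetric] by blast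
  qed
  have ext: "?ext (b, T) \<in> tableaux (insert M L) Q a \<and> ?cut (?ext (b, T)) = (b, T)"
    if bT: "b \<in> ?B" "T \<in> tableaux L Q b" for b T
  proof -
    have il: "b i \<le> a i" "a (Suc i) \<le> b i" for i using bT by (auto simp: interlace_def)
    have sub: "young b \<subseteq> young a" by (rule young_mono) (rule il)
    have TL: "T p \<in> L" if "p \<in> young b" for p using bT that by (auto simp: tableaux_def)
    have rows: "(m, n) \<in> young b" if "(m, n') \<in> young b" "(m, n) \<in> young a" "n < n'" for m n n'
      using that by (auto simp: young_def)
    \<comment> \<open>By interlacing, a box of \<open>a\<close> with a further box of
      \<open>a\<close> below it lies in \<open>b\<close>; hence nothing sits below an added
      \<open>M\<close>.\<close>
    have cols: "(m, n) \<in> young b" if mm: "(m, n) \<in> young a" "(m', n) \<in> young a" "m < m'" for m m' n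
    proof -
      have "n \<le> a (m' - 1)" "1 \<le> m" "m \<le> m' - 1" using mm by (auto simp: young_def)
      then have "n \<le> a (Suc (m - 1))" using antimonoD[OF anti, of m "m' - 1"] by simp
      then show ?thesis using il(2)[of "m - 1"] mm by (auto simp: young_def)
    qed
    have QM: "Q m M" if "(m, n) \<in> young a" "(m, n) \<notin> young b" for m n
    proof -
      have "b (m - 1) < a (m - 1)" "1 \<le> m" using that by (auto simp: young_def)
      then show ?thesis using bT(1) by (cases m) auto
    qed
    have TM: "T p < M" if "p \<in> young b" for p using M TL that by blast
    define E where "E = ?ext (b, T)"
    have E: "E p = (if p \<in> young b then T p else if p \<in> young a then M else undefined)" for p
      by (simp add: E_def)
    have "E \<in> young a \<rightarrow>\<^sub>E insert M L" using E TL sub by (auto simp: PiE_def extensional_def)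
    moreover have "E (m, n) \<le> E (m, n')" if "(m, n) \<in> young a" "(m, n') \<in> young a" "n < n'" for m n n'
    proof (cases "(m, n') \<in> young b")
      case True
      then have "T (m, n) \<le> T (m, n')" using bT(2) rows[OF True that(1,3)] that(3) unfolding tableaux_def by blast
      then show ?thesis using E True rows[OF True that(1,3)] by simp
    next
      case False
      then show ?thesis using E that TM[of "(m, n)"] by (simp add: less_imp_le)
    qed
    moreover have "E (m, n) < E (m', n)" if "(m, n) \<in> young a" "(m', n) \<in> young a" "m < m'" for m m' n
    proof (cases "(m', n) \<in> young b")
      case True
      then have "T (m, n) < T (m', n)" using bT(2) cols[OF that] that(3) unfolding tableaux_def by blast
      then show ?thesis using E True cols[OF that] by simp
    next
      case False
      then show ?thesis using E that cols[OF that] TM[of "(m, n)"] by simp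
    qed
    moreover have "Q m (E (m, n))" if "(m, n) \<in> young a" for m n
      using E that QM[OF that] bT(2) unfolding tableaux_def by simp
    ultimately have 1: "?ext (b, T) \<in> tableaux (insert M L) Q a"
      unfolding E_def[symmetric] tableaux_def by blast
    have "?sh (?ext (b, T)) i = b i" for i
    proof -
      have "?D (?ext (b, T)) i = {1..b i}"
        using TL M il(1)[of i] by (auto simp: young_def less_le split: if_splits)
      then show ?thesis by simp
    qed
    then have sh: "?sh (?ext (b, T)) = b" by auto
    have "restrict (?ext (b, T)) (young b) = T"
      using bT(2) by (auto simp: tableaux_def fun_eq_iff PiE_def extensional_def)
    then show ?thesis using 1 sh by simp
  qed
  have "tableau_sum (insert M L) Q v a =
      (\<Sum>(b, T)\<in>?S. v M ^ (boxes a - boxes b) * (\<Prod>p\<in>young b. v (T p)))"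
    unfolding tableau_sum_def
  proof (rule sum.reindex_bij_witness[of _ ?ext ?cut])
    fix T assume T: "T \<in> tableaux (insert M L) Q a"
    show "?ext (?cut T) = T" "?cut T \<in> ?S" using cut[OF T] by blast+
    let ?b = "?sh T"
    have yb: "young ?b = {p \<in> young a. T p \<noteq> M}" using cut[OF T] by blast
    have il: "interlace a ?b" using cut[OF T] by blast
    then have sb: "shape ?b" using a interlace_shape by blast
    have "(\<Prod>p\<in>young a. v (T p)) = (\<Prod>p\<in>young a - young ?b. v (T p)) * (\<Prod>p\<in>young ?b. v (T p))"
      by (rule prod.subset_diff) (use yb finite_young[OF a] in auto)
    also have "(\<Prod>p\<in>young a - young ?b. v (T p)) = (\<Prod>p\<in>young a - young ?b. v M)"
      by (rule prod.cong) (use yb in auto)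
    also have "card (young a - young ?b) = boxes a - boxes ?b"
      using card_Diff_subset[of "young ?b" "young a"] yb finite_young[OF sb] card_young[OF sb] card_young[OF a]
      by auto
    then have "(\<Prod>p\<in>young a - young ?b. v M) = v M ^ (boxes a - boxes ?b)" by simp
    finally show "(case ?cut T of (b, T) \<Rightarrow> v M ^ (boxes a - boxes b) * (\<Prod>p\<in>young b. v (T p))) = (\<Prod>p\<in>young a. v (T p))"
      by simp
  next
    fix x assume "x \<in> ?S"
    then obtain b T where x: "x = (b, T)" "b \<in> ?B" "T \<in> tableaux L Q b" by auto
    show "?cut (?ext x) = x" "?ext x \<in> tableaux (insert M L) Q a"
      using ext[OF x(2,3)] unfolding x(1) by blast+
  qed
  also have "\<dots> = (\<Sum>b\<in>?B. \<Sum>T\<in>tableaux L Q b. v M ^ (boxes a - boxes b) * (\<Prod>p\<in>young b. v (T p)))"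
    by (rule sum.Sigma[symmetric]) (use finB finite_tableaux[OF fin] a interlace_shape in blast)+
  finally show ?thesis by (simp add: tableau_sum_def sum_distrib_left)
qed

lemma tableau_sum_insert_strip_down:
  assumes "finite L" "\<And>t. t \<in> L \<Longrightarrow> t < M" "shape a" "\<And>i. a i \<noteq> 0 \<Longrightarrow> Q (Suc i) M"
  shows "tableau_sum (insert M L) Q v a = strip_down (v M) (tableau_sum L Q v) a"
proof -
  have "\<forall>i. b i < a i \<longrightarrow> Q (Suc i) M" for b :: "nat \<Rightarrow> nat" using assms(4) by (metis less_zeroE)
  then show ?thesis using tableau_sum_insert[OF assms(1-3), of Q v] by (simp add: strip_down_def)
qed

lemma schur_pieri:
  fixes v :: "'l::linorder \<Rightarrow> 'r::comm_ring_1"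
  assumes "finite L" "shape a"
  shows "strip_up (tableau_sum L (\<lambda>_ _. True) v) a =
    (\<Prod>t\<in>L. geometric (v t)) * fps_const (tableau_sum L (\<lambda>_ _. True) v a)"
  using assms
proof (induction L arbitrary: a rule: finite_linorder_max_induct)
  case empty
  then show ?case by (simp add: tableau_sum_empty strip_up_unit_shape)
next
  case (insert M L)
  have ins: "tableau_sum (insert M L) (\<lambda>_ _. True) v b = strip_down (v M) (tableau_sum L (\<lambda>_ _. True) v) b"
    if "shape b" for b
    by (rule tableau_sum_insert_strip_down) (use insert that in auto)
  have "strip_up (tableau_sum (insert M L) (\<lambda>_ _. True) v) a = strip_up (strip_down (v M) (tableau_sum L (\<lambda>_ _. True) v)) a"
    by (rule strip_up_cong) (use ins interlace_shape insert.prems in blast)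
  also have "\<dots> = geometric (v M) * (\<Prod>t\<in>L. geometric (v t)) * fps_const (strip_down (v M) (tableau_sum L (\<lambda>_ _. True) v) a)"
    by (rule strip_down_pieri) (use insert in auto)
  finally show ?case using insert ins[OF insert.prems] by (auto simp: prod.insert_if)
qed

section \<open>King tableaux and the symplectic Pieri rule\<close>

definition king_sum :: "nat \<Rightarrow> (letter \<Rightarrow> 'r::comm_ring_1) \<Rightarrow> (nat \<Rightarrow> nat) \<Rightarrow> 'r" where
  "king_sum k = tableau_sum (barred_alphabet k) (\<lambda>m t. Plain m \<le> t)"

lemma barred_alphabet_Suc:
  "barred_alphabet (Suc k) = insert (Barred (Suc k)) (insert (Plain (Suc k)) (barred_alphabet k))"
  unfolding barred_alphabet_def by (auto simp: atLeastAtMostSuc_conv)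

text \<open>A shape with more than k rows has a box in row k + 1, whose entry would be at least
  \<open>Plain (Suc k)\<close>, beyond the alphabet.\<close>

lemma king_sum_eq_0:
  assumes "shape a" "a \<notin> shapes k"
  shows "king_sum k v a = 0"
proof -
  have "a k \<noteq> 0" using assms by (auto simp: shape_def shapes_def)
  then have "(Suc k, 1) \<in> young a" by (simp add: young_def)
  moreover have "\<not> Plain (Suc k) \<le> t" if "t \<in> barred_alphabet k" for t
    using that by (auto simp: barred_alphabet_def less_eq_letter_def)
  moreover have "T (Suc k, 1) \<in> barred_alphabet k" "Plain (Suc k) \<le> T (Suc k, 1)"
    if "T \<in> tableaux (barred_alphabet k) (\<lambda>m t. Plain m \<le> t) a" "(Suc k, 1) \<in> young a" for T
    using that PiE_mem[of T "young a" "\<lambda>_. barred_alphabet k"] unfolding tableaux_def by blast+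
  ultimately have "tableaux (barred_alphabet k) (\<lambda>m t. Plain m \<le> t) a = {}" by blast
  then show ?thesis by (simp add: king_sum_def tableau_sum_def)
qed

text \<open>Both new letters are admissible in each of the first k + 1 rows, so the King condition
  does not restrict their removal; the barred one, being the largest, goes first.\<close>

lemma king_sum_Suc:
  assumes "a \<in> shapes (Suc k)"
  shows "king_sum (Suc k) v a =
    strip_down (v (Barred (Suc k))) (strip_down (v (Plain (Suc k))) (king_sum k v)) a"
proof -
  let ?Q = "\<lambda>m t. Plain m \<le> t"
  have fin: "finite (barred_alphabet k)" by (simp add: barred_alphabet_def)
  have row: "i \<le> k" if "b \<in> shapes (Suc k)" "0 < b i" for b i
    using shapes_zero[OF that(1), of i] that(2) by (cases "i \<le> k") auto
  have lt: "t < Plain (Suc k)" if "t \<in> barred_alphabet k" for t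
    using that by (auto simp: barred_alphabet_def less_letter_def)
  have lt': "t < Barred (Suc k)" if "t \<in> insert (Plain (Suc k)) (barred_alphabet k)" for t
    using that by (auto simp: barred_alphabet_def less_letter_def)
  have "tableau_sum (insert (Plain (Suc k)) (barred_alphabet k)) ?Q v b =
      strip_down (v (Plain (Suc k))) (king_sum k v) b" if "b \<in> shapes (Suc k)" for b
    unfolding king_sum_def
    by (rule tableau_sum_insert_strip_down[OF fin lt shapes_shape[OF that]])
      (auto simp: less_eq_letter_def dest: row[OF that])
  moreover have "king_sum (Suc k) v a = strip_down (v (Barred (Suc k)))
      (tableau_sum (insert (Plain (Suc k)) (barred_alphabet k)) ?Q v) a"
    unfolding king_sum_def barred_alphabet_Suc
    by (rule tableau_sum_insert_strip_down[OF _ lt' shapes_shape[OF assms]])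
      (auto simp: less_eq_letter_def fin dest: row[OF assms])
  ultimately show ?thesis
    using interlace_shapes_lower[OF _ assms] by (simp cong: strip_down_cong)
qed

text \<open>By \<open>king_sum_eq_0\<close> the condition only cuts off junk values at functions that are not shapes.\<close>

lemma king_pieri:
  fixes v :: "letter \<Rightarrow> 'r::comm_ring_1"
  assumes inv: "\<And>j. v (Plain j) * v (Barred j) = 1" and a: "a \<in> shapes k"
  shows "strip_down fps_X (strip_up (\<lambda>a. if a \<in> shapes k then king_sum k v a else 0)) a =
    (\<Prod>j = 1..k. geometric (v (Plain j)) * geometric (v (Barred j))) * fps_const (king_sum k v a)"
  using a
proof (induction k arbitrary: a)
  case 0
  have u: "(\<lambda>a. if a \<in> shapes 0 then king_sum 0 v a else 0) = unit_shape"
    by (auto simp: king_sum_def barred_alphabet_def tableau_sum_empty unit_shape_def shapes_0_iff)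
  have "a = (\<lambda>_. 0)" using 0 by (simp add: shapes_0_iff)
  moreover have "{b. interlace (\<lambda>_. 0) b} = {\<lambda>_. 0}" by (auto simp: interlace_def)
  ultimately show ?case
    unfolding u by (simp add: strip_down_def strip_up_unit_shape king_sum_def barred_alphabet_def tableau_sum_empty)
next
  case (Suc k)
  let ?s = "\<lambda>a. if a \<in> shapes k then king_sum k v a else 0"
  let ?s' = "\<lambda>a. if a \<in> shapes (Suc k) then king_sum (Suc k) v a else 0"
  have s': "?s' a = (if a \<in> shapes (Suc k) then strip_down (v (Barred (Suc k))) (strip_down (v (Plain (Suc k))) ?s) a else 0)" for a
  proof (cases "a \<in> shapes (Suc k)")
    case True
    have "king_sum k v b = ?s b" if "shape b" for b using king_sum_eq_0[OF that] by auto
    then have "strip_down (v (Plain (Suc k))) (king_sum k v) b = strip_down (v (Plain (Suc k))) ?s b" if "shape b" for b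
      by (rule strip_down_cong) (use interlace_shape that in blast)
    then have "strip_down (v (Barred (Suc k))) (strip_down (v (Plain (Suc k))) (king_sum k v)) a =
        strip_down (v (Barred (Suc k))) (strip_down (v (Plain (Suc k))) ?s) a"
      by (rule strip_down_cong) (use interlace_shape shapes_shape[OF True] in blast)
    then show ?thesis using True king_sum_Suc[OF True, of v] by simp
  qed simp
  have "strip_down fps_X (strip_up ?s) a = (\<Prod>j = 1..k. geometric (v (Plain j)) * geometric (v (Barred j))) * fps_const (?s a)"
    if "a \<in> shapes k" for a
    using Suc.IH[OF that] that by simp
  from king_pieri_step[OF inv _ this s' Suc.prems] show ?case
    using Suc.prems by (simp add: ac_simps)
qed

section \<open>Weighted walks\<close>

text \<open>\<open>K n a b\<close> is the number of steps of size n from b to a, and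
  \<open>g i\<close> is the size of step i. Summing over nonzero kernel values only makes the index
  sets finite for the kernels in use.\<close>

primrec walks :: "(nat \<Rightarrow> 'b \<Rightarrow> 'b \<Rightarrow> nat) \<Rightarrow> 'b \<Rightarrow> (nat \<Rightarrow> nat) \<Rightarrow> nat \<Rightarrow> 'b \<Rightarrow> nat" where
  "walks K s0 g 0 = (\<lambda>a. if a = s0 then 1 else 0)"
| "walks K s0 g (Suc j) = (\<lambda>a. \<Sum>b | K (g (Suc j)) a b \<noteq> 0. K (g (Suc j)) a b * walks K s0 g j b)"

lemma walks_cong:
  "(\<And>i. i \<in> {1..j} \<Longrightarrow> g i = g' i) \<Longrightarrow> walks K s0 g j = walks K s0 g' j"
  by (induction j) auto

text \<open>Iterates the eigenvector relation \<open>pieri\<close>. It is demanded only on the set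
  \<open>A j\<close> reached after j < N steps, because the symplectic rule controls the step only
  as long as no shape exceeds the row bound.\<close>

lemma walks_sum:
  fixes s :: "'b \<Rightarrow> 'r::comm_ring_1"
  assumes finB: "\<And>n a. finite {b. K n a b \<noteq> 0}" and finA: "\<And>n b. finite {a. K n a b \<noteq> 0}"
    and start: "s0 \<in> A 0"
    and step: "\<And>j n a b. b \<in> A j \<Longrightarrow> K n a b \<noteq> 0 \<Longrightarrow> a \<in> A (Suc j)"
    and pieri: "\<And>j n b. j < N \<Longrightarrow> b \<in> A j \<Longrightarrow> (\<Sum>a | K n a b \<noteq> 0. of_nat (K n a b) * s a) = h n * s b"
    and "j \<le> N"
  shows "finite {a. walks K s0 g j a \<noteq> 0} \<and> {a. walks K s0 g j a \<noteq> 0} \<subseteq> A j \<and>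
    (\<Sum>a | walks K s0 g j a \<noteq> 0. of_nat (walks K s0 g j a) * s a) = (\<Prod>i = 1..j. h (g i)) * s s0"
  using \<open>j \<le> N\<close>
proof (induction j)
  case 0
  have "{a. walks K s0 g 0 a \<noteq> 0} = {s0}" by auto
  then show ?case using start by simp
next
  case (Suc j)
  let ?w = "walks K s0 g j" and ?w' = "walks K s0 g (Suc j)" and ?n = "g (Suc j)"
  let ?W = "{b. ?w b \<noteq> 0}"
  have IH: "finite ?W" "?W \<subseteq> A j" "(\<Sum>a\<in>?W. of_nat (?w a) * s a) = (\<Prod>i = 1..j. h (g i)) * s s0"
    using Suc by simp_all
  define F where "F = (\<Union>b\<in>?W. {a. K ?n a b \<noteq> 0})"
  have finF: "finite F" unfolding F_def using IH(1) finA by blast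
  have w': "?w' a = (\<Sum>b\<in>?W. K ?n a b * ?w b)" for a
    unfolding walks.simps by (rule sum.mono_neutral_cong) (use finB IH(1) in auto)
  have sub: "{a. ?w' a \<noteq> 0} \<subseteq> F"
  proof
    fix a assume "a \<in> {a. ?w' a \<noteq> 0}"
    then have "\<exists>b\<in>?W. K ?n a b * ?w b \<noteq> 0"
      unfolding w' mem_Collect_eq by (metis (mono_tags, lifting) sum.neutral)
    then show "a \<in> F" unfolding F_def by auto
  qed
  have "(\<Sum>a | ?w' a \<noteq> 0. of_nat (?w' a) * s a) = (\<Sum>a\<in>F. of_nat (?w' a) * s a)"
    by (rule sum.mono_neutral_left[OF finF sub]) auto
  also have "\<dots> = (\<Sum>b\<in>?W. of_nat (?w b) * (\<Sum>a\<in>F. of_nat (K ?n a b) * s a))"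
    unfolding w' by (simp add: sum_distrib_left sum_distrib_right ac_simps) (rule sum.swap)
  also have "\<dots> = (\<Sum>b\<in>?W. of_nat (?w b) * (h ?n * s b))"
  proof (rule sum.cong[OF refl])
    fix b assume b: "b \<in> ?W"
    have "(\<Sum>a\<in>F. of_nat (K ?n a b) * s a) = (\<Sum>a | K ?n a b \<noteq> 0. of_nat (K ?n a b) * s a)"
      by (rule sum.mono_neutral_right[OF finF]) (use b in \<open>auto simp: F_def\<close>)
    then show "of_nat (?w b) * (\<Sum>a\<in>F. of_nat (K ?n a b) * s a) = of_nat (?w b) * (h ?n * s b)"
      using pieri[of j b ?n] b IH(2) Suc.prems by auto
  qed
  also have "\<dots> = h ?n * (\<Sum>b\<in>?W. of_nat (?w b) * s b)"
    by (simp add: sum_distrib_left ac_simps)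
  also have "\<dots> = (\<Prod>i = 1..Suc j. h (g i)) * s s0"
    unfolding IH(3) by (simp add: ac_simps)
  finally have "(\<Sum>a | ?w' a \<noteq> 0. of_nat (?w' a) * s a) = (\<Prod>i = 1..Suc j. h (g i)) * s s0" .
  moreover have "F \<subseteq> A (Suc j)" unfolding F_def using IH(2) step by blast
  ultimately show ?case using sub finite_subset[OF sub finF] by blast
qed

section \<open>Strip walks and oscillating walks\<close>

definition strip_kernel :: "nat \<Rightarrow> (nat \<Rightarrow> nat) \<Rightarrow> (nat \<Rightarrow> nat) \<Rightarrow> nat" where
  "strip_kernel n a b = (if shape a \<and> interlace a b \<and> boxes a = boxes b + n then 1 else 0)"

text \<open>The same two shapes can be joined by several oscillating steps of one size, so the value
  is a number of middle shapes \<open>c\<close>. The clause \<open>shape a\<close> makes the set of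
  these finite.\<close>

definition osc_kernel :: "nat \<Rightarrow> (nat \<Rightarrow> nat) \<Rightarrow> (nat \<Rightarrow> nat) \<Rightarrow> nat" where
  "osc_kernel n a b =
    card {c. shape a \<and> interlace a c \<and> interlace b c \<and> (boxes b - boxes c) + (boxes a - boxes c) = n}"

lemma strip_kernel_walks:
  fixes v :: "'l::linorder \<Rightarrow> 'r::comm_ring_1"
  assumes "finite L"
  defines "s \<equiv> tableau_sum L (\<lambda>_ _. True) v" and "w \<equiv> walks strip_kernel (\<lambda>_. 0)"
  shows "finite {a. w g j a \<noteq> 0}" "{a. w g j a \<noteq> 0} \<subseteq> shapes j"
    "(\<Sum>a | w g j a \<noteq> 0. of_nat (w g j a) * s a) = (\<Prod>i = 1..j. (\<Prod>t\<in>L. geometric (v t)) $ g i) * s (\<lambda>_. 0)"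
proof -
  have finB: "finite {b. strip_kernel n a b \<noteq> 0}" for n a
    by (cases "shape a") (auto simp: strip_kernel_def intro: finite_subset[OF _ finite_interlace_lower])
  have finA: "finite {a. strip_kernel n a b \<noteq> 0}" for n b
    by (rule finite_subset[OF _ finite_shapes_bounded[of "boxes b + n"]]) (auto simp: strip_kernel_def)
  have step: "a \<in> shapes (Suc j)" if "b \<in> shapes j" "strip_kernel n a b \<noteq> 0" for j n a b
    using that interlace_shapes_upper by (auto simp: strip_kernel_def split: if_splits)
  have pieri: "(\<Sum>a | strip_kernel n a b \<noteq> 0. of_nat (strip_kernel n a b) * s a) = (\<Prod>t\<in>L. geometric (v t)) $ n * s b"
    if "b \<in> shapes j" for j n b
  proof -
    have sb: "shape b" using that by (rule shapes_shape)
    have "(\<Sum>a | strip_kernel n a b \<noteq> 0. of_nat (strip_kernel n a b) * s a) =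
        (\<Sum>a | interlace a b \<and> boxes a = boxes b + n. s a)"
      by (rule sum.cong) (use sb interlace_shape in \<open>auto simp: strip_kernel_def split: if_splits\<close>)
    also have "\<dots> = strip_up s b $ n" by (simp add: strip_up_def)
    finally show ?thesis unfolding s_def schur_pieri[OF assms(1) sb] by simp
  qed
  have walks: "finite {a. w g j a \<noteq> 0} \<and> {a. w g j a \<noteq> 0} \<subseteq> shapes j \<and>
    (\<Sum>a | w g j a \<noteq> 0. of_nat (w g j a) * s a) = (\<Prod>i = 1..j. (\<Prod>t\<in>L. geometric (v t)) $ g i) * s (\<lambda>_. 0)"
    unfolding w_def
    by (rule walks_sum[where A = shapes and N = j])
      ((rule finB finA zero_in_shapes order_refl) | (rule step, assumption+) | (rule pieri, assumption+))+
  show "finite {a. w g j a \<noteq> 0}" "{a. w g j a \<noteq> 0} \<subseteq> shapes j"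
    "(\<Sum>a | w g j a \<noteq> 0. of_nat (w g j a) * s a) = (\<Prod>i = 1..j. (\<Prod>t\<in>L. geometric (v t)) $ g i) * s (\<lambda>_. 0)"
    using walks by blast+
qed

lemma finite_osc_kernel:
  "finite {c. shape a \<and> interlace a c \<and> interlace b c \<and> (boxes b - boxes c) + (boxes a - boxes c) = n}"
  by (cases "shape a") (auto intro: finite_subset[OF _ finite_interlace_lower[of a]])

lemma osc_kernel_nonzeroE:
  assumes "osc_kernel n a b \<noteq> 0"
  obtains c where "shape a" "shape b" "interlace a c" "interlace b c" "boxes b - boxes c + (boxes a - boxes c) = n"
    "boxes a \<le> boxes b + n" "boxes b \<le> boxes a + n"
proof -
  obtain c where c: "shape a" "interlace a c" "interlace b c" "boxes b - boxes c + (boxes a - boxes c) = n"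
    using assms unfolding osc_kernel_def by (metis (mono_tags, lifting) Collect_empty_eq card.empty)
  then have sc: "shape c" "shape b" using interlace_shape by blast+
  then have "boxes c \<le> boxes a" "boxes c \<le> boxes b" using c interlace_boxes_le by blast+
  then have "boxes a \<le> boxes b + n" "boxes b \<le> boxes a + n" using c(4) by linarith+
  then show ?thesis using that c sc by blast
qed

lemma osc_kernel_nonzeroD:
  assumes "osc_kernel n a b \<noteq> 0"
  shows "shape a" "shape b" "boxes a \<le> boxes b + n" "boxes b \<le> boxes a + n"
proof -
  from assms obtain c where "shape a" "shape b" "boxes a \<le> boxes b + n" "boxes b \<le> boxes a + n"
    by (rule osc_kernel_nonzeroE)
  then show "shape a" "shape b" "boxes a \<le> boxes b + n" "boxes b \<le> boxes a + n" by simp_all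
qed

lemma osc_kernel_walks:
  fixes v :: "letter \<Rightarrow> 'r::comm_ring_1"
  assumes inv: "\<And>j. v (Plain j) * v (Barred j) = 1"
  defines "h \<equiv> \<lambda>k. \<Prod>j = 1..k. geometric (v (Plain j)) * geometric (v (Barred j))"
    and "w \<equiv> walks osc_kernel (\<lambda>_. 0)"
  shows "finite {a. w g k a \<noteq> 0}" "{a. w g k a \<noteq> 0} \<subseteq> shapes k"
    "(\<Sum>a | w g k a \<noteq> 0. of_nat (w g k a) * king_sum k v a) = (\<Prod>i = 1..k. h k $ g i) * king_sum k v (\<lambda>_. 0)"
proof -
  let ?s = "\<lambda>a. if a \<in> shapes k then king_sum k v a else 0"
  have finB: "finite {b. osc_kernel n a b \<noteq> 0}" for n a
    by (rule finite_subset[OF _ finite_shapes_bounded[of "boxes a + n"]]) (use osc_kernel_nonzeroD in blast)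
  have finA: "finite {a. osc_kernel n a b \<noteq> 0}" for n b
    by (rule finite_subset[OF _ finite_shapes_bounded[of "boxes b + n"]]) (use osc_kernel_nonzeroD in blast)
  have step: "a \<in> shapes (Suc j)" if "b \<in> shapes j" "osc_kernel n a b \<noteq> 0" for j n a b
    using that(2)
  proof (rule osc_kernel_nonzeroE)
    fix c assume "interlace a c" "interlace b c"
    then show ?thesis using that(1) interlace_shapes_upper interlace_shapes_lower by blast
  qed
  have pieri: "(\<Sum>a | osc_kernel n a b \<noteq> 0. of_nat (osc_kernel n a b) * king_sum k v a) = h k $ n * king_sum k v b"
    if j: "j < k" "b \<in> shapes j" for j n b
  proof -
    let ?C = "{c. interlace b c \<and> boxes b - boxes c \<le> n}"
    let ?P = "\<lambda>a c. interlace a c \<and> boxes b - boxes c + (boxes a - boxes c) = n"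
    have bk: "b \<in> shapes k" using j shapes_mono[of j k] by auto
    have sb: "shape b" using shapes_shape[OF bk] .
    \<comment> \<open>Here j < k matters: from at most j rows a step leads to at most j + 1 \<le> k
      rows, so the truncation in \<open>king_pieri\<close> cuts nothing off.\<close>
    have ak: "a \<in> shapes k" if "interlace a c" "interlace b c" for a c
      using interlace_shapes_upper[OF that(1) interlace_shapes_lower[OF that(2) j(2)]] j(1)
        shapes_mono[of "Suc j" k] by auto
    have finC: "finite ?C" by (rule finite_subset[OF _ finite_interlace_lower[OF sb]]) auto
    have "h k $ n * king_sum k v b = strip_down fps_X (strip_up ?s) b $ n"
      using king_pieri[of v b k, OF inv bk] by (simp add: h_def)
    \<comment> \<open>The power of \<open>fps_X\<close> accounts for the deleted boxes, and the rest
      of the n boxes must be added.\<close>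
    also have "\<dots> = (\<Sum>c | interlace b c. if boxes b - boxes c \<le> n then
        (\<Sum>a | interlace a c \<and> boxes a = boxes c + (n - (boxes b - boxes c)). ?s a) else 0)"
      unfolding strip_down_def fps_sum_nth
      by (intro sum.cong refl) (auto simp: fps_X_power_mult_nth strip_up_def)
    also have "\<dots> = (\<Sum>c\<in>?C. \<Sum>a | interlace a c \<and> boxes a = boxes c + (n - (boxes b - boxes c)). ?s a)"
      by (rule sum.mono_neutral_cong_right[OF finite_interlace_lower[OF sb]]) auto
    also have "\<dots> = (\<Sum>c\<in>?C. \<Sum>a | a \<in> {a. osc_kernel n a b \<noteq> 0} \<and> ?P a c. king_sum k v a)"
    proof (rule sum.cong[OF refl], rule sum.cong)
      fix c assume c: "c \<in> ?C"
      have sc: "shape c" using c sb interlace_shape by blast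
      have le: "boxes c \<le> boxes a" if "interlace a c" for a
        using that interlace_boxes_le interlace_shape sc by blast
      have "osc_kernel n a b \<noteq> 0" if "?P a c" for a
      proof -
        have "shape a" using that sc interlace_shape by blast
        then have "{c. shape a \<and> interlace a c \<and> interlace b c \<and> (boxes b - boxes c) + (boxes a - boxes c) = n} \<noteq> {}"
          using that c by blast
        then show ?thesis unfolding osc_kernel_def card_eq_0_iff using finite_osc_kernel[of a b n] by blast
      qed
      show "{a. interlace a c \<and> boxes a = boxes c + (n - (boxes b - boxes c))} = {a. a \<in> {a. osc_kernel n a b \<noteq> 0} \<and> ?P a c}"
      proof -
        have "boxes a = boxes c + (n - (boxes b - boxes c)) \<longleftrightarrow> boxes b - boxes c + (boxes a - boxes c) = n"
          if "interlace a c" for a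
          using le[OF that] c by auto
        then show ?thesis using \<open>\<And>a. ?P a c \<Longrightarrow> osc_kernel n a b \<noteq> 0\<close> by blast
      qed
      show "?s a = king_sum k v a" if "a \<in> {a. a \<in> {a. osc_kernel n a b \<noteq> 0} \<and> ?P a c}" for a
        using that ak[of a c] c by auto
    qed
    also have "\<dots> = (\<Sum>a | osc_kernel n a b \<noteq> 0. \<Sum>c | c \<in> ?C \<and> ?P a c. king_sum k v a)"
      by (rule sum.swap_restrict[OF finC finA])
    also have "\<dots> = (\<Sum>a | osc_kernel n a b \<noteq> 0. of_nat (osc_kernel n a b) * king_sum k v a)"
    proof (rule sum.cong[OF refl])
      fix a assume "a \<in> {a. osc_kernel n a b \<noteq> 0}"
      then have "shape a" using osc_kernel_nonzeroD(1) by blast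
      then have "{c. c \<in> ?C \<and> ?P a c} =
          {c. shape a \<and> interlace a c \<and> interlace b c \<and> (boxes b - boxes c) + (boxes a - boxes c) = n}"
        by auto
      then show "(\<Sum>c | c \<in> ?C \<and> ?P a c. king_sum k v a) = of_nat (osc_kernel n a b) * king_sum k v a"
        by (simp only: sum_constant osc_kernel_def)
    qed
    finally show ?thesis ..
  qed
  have walks: "finite {a. w g k a \<noteq> 0} \<and> {a. w g k a \<noteq> 0} \<subseteq> shapes k \<and>
    (\<Sum>a | w g k a \<noteq> 0. of_nat (w g k a) * king_sum k v a) = (\<Prod>i = 1..k. h k $ g i) * king_sum k v (\<lambda>_. 0)"
    unfolding w_def
    by (rule walks_sum[where A = shapes and N = k])
      ((rule finB finA zero_in_shapes order_refl) | (rule step, assumption+) | (rule pieri, assumption+))+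
  show "finite {a. w g k a \<noteq> 0}" "{a. w g k a \<noteq> 0} \<subseteq> shapes k"
    "(\<Sum>a | w g k a \<noteq> 0. of_nat (w g k a) * king_sum k v a) = (\<Prod>i = 1..k. h k $ g i) * king_sum k v (\<lambda>_. 0)"
    using walks by blast+
qed

lemma tableau_sum_zero [simp]: "tableau_sum L Q v (\<lambda>_. 0) = 1"
proof -
  have "young (\<lambda>_. 0) = {}" by (simp add: young_empty_iff)
  then show ?thesis by (simp add: tableau_sum_def tableaux_def)
qed

section \<open>Power series in one of the variables\<close>

lemma mvps_coeff_Abs [simp]: "mvps_coeff (Abs_mvps f) = f"
  by (simp add: Abs_mvps_inverse)

lemma mvps_coeff_times: "mvps_coeff (f * g) a = (\<Sum>(b, c)\<in>exp_splits a. mvps_coeff f b * mvps_coeff g c)"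
  by transfer simp

lemma mvps_coeff_sum: "mvps_coeff (sum f A) a = (\<Sum>x\<in>A. mvps_coeff (f x) a)"
  by (induction A rule: infinite_finite_induct) (simp_all add: zero_mvps.rep_eq plus_mvps.rep_eq)

text \<open>The substitution of y_i into a one-variable series: exponent vectors with keys in {i}
  are the powers of y_i.\<close>

definition mvps_of_fps :: "nat \<Rightarrow> 'r::comm_ring_1 fps \<Rightarrow> 'r mvps" where
  "mvps_of_fps i f = Abs_mvps (\<lambda>a. if Poly_Mapping.keys a \<subseteq> {i} then f $ Poly_Mapping.lookup a i else 0)"

lemma keys_subset_single: "Poly_Mapping.keys a \<subseteq> {i} \<Longrightarrow> a = Poly_Mapping.single i (Poly_Mapping.lookup a i)"
  by (rule poly_mapping_eqI) (auto simp: lookup_single when_def in_keys_iff)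

lemma keys_plus_nat:
  fixes a b :: "nat \<Rightarrow>\<^sub>0 nat"
  shows "Poly_Mapping.keys (a + b) = Poly_Mapping.keys a \<union> Poly_Mapping.keys b"
  by (auto simp: in_keys_iff lookup_add)

text \<open>Exponents are natural numbers, so a power of y_i splits only into powers of y_i, and the
  convolution reduces to the Cauchy product.\<close>

lemma mvps_of_fps_times: "mvps_of_fps i (f * g) = mvps_of_fps i f * mvps_of_fps i g"
proof (rule mvps_eqI)
  fix a
  let ?F = "mvps_of_fps i f" and ?G = "mvps_of_fps i g"
  show "mvps_coeff (mvps_of_fps i (f * g)) a = mvps_coeff (?F * ?G) a"
  proof (cases "Poly_Mapping.keys a \<subseteq> {i}")
    case True
    let ?n = "Poly_Mapping.lookup a i"
    have a: "a = Poly_Mapping.single i ?n" by (rule keys_subset_single[OF True])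
    have k: "Poly_Mapping.keys b \<subseteq> {i} \<and> Poly_Mapping.keys c \<subseteq> {i}" if "b + c = a" for b c
      using True that by (auto simp: keys_plus_nat)
    have "(\<Sum>j = 0..?n. f $ j * g $ (?n - j)) = (\<Sum>(b, c)\<in>exp_splits a. mvps_coeff ?F b * mvps_coeff ?G c)"
    proof (rule sum.reindex_bij_witness[of _ "\<lambda>(b, c). Poly_Mapping.lookup b i"
          "\<lambda>j. (Poly_Mapping.single i j, Poly_Mapping.single i (?n - j))"])
      fix j assume j: "j \<in> {0..?n}"
      then show "(Poly_Mapping.single i j, Poly_Mapping.single i (?n - j)) \<in> exp_splits a"
        by (subst a) (simp add: exp_splits_def flip: single_add)
      show "(case (Poly_Mapping.single i j, Poly_Mapping.single i (?n - j)) of (b, c) \<Rightarrow> mvps_coeff ?F b * mvps_coeff ?G c)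
         = f $ j * g $ (?n - j)"
        by (auto simp: mvps_of_fps_def)
    next
      fix x assume "x \<in> exp_splits a"
      then obtain b c where x: "x = (b, c)" and bc: "b + c = a" by (auto simp: exp_splits_def)
      have "?n = Poly_Mapping.lookup b i + Poly_Mapping.lookup c i" by (simp add: bc[symmetric] lookup_add)
      then show "(\<lambda>j. (Poly_Mapping.single i j, Poly_Mapping.single i (?n - j))) (case x of (b, c) \<Rightarrow> Poly_Mapping.lookup b i) = x"
        "(case x of (b, c) \<Rightarrow> Poly_Mapping.lookup b i) \<in> {0..?n}"
        using k[OF bc] keys_subset_single[of b i] keys_subset_single[of c i] by (simp_all add: x)
    qed (simp add: lookup_single)
    then show ?thesis using True by (simp add: mvps_coeff_times mvps_of_fps_def fps_mult_nth)
  next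
    case False
    then have "\<not> Poly_Mapping.keys b \<subseteq> {i} \<or> \<not> Poly_Mapping.keys c \<subseteq> {i}" if "b + c = a" for b c
      using that by (auto simp: keys_plus_nat)
    then have "(\<Sum>(b, c)\<in>exp_splits a. mvps_coeff ?F b * mvps_coeff ?G c) = 0"
      by (intro sum.neutral) (auto simp: exp_splits_def mvps_of_fps_def)
    then show ?thesis using False by (simp add: mvps_coeff_times mvps_of_fps_def)
  qed
qed

lemma mvps_of_fps_const: "mvps_of_fps i (fps_const c) = mvps_const c"
proof (rule mvps_eqI)
  fix a :: "nat \<Rightarrow>\<^sub>0 nat"
  have "Poly_Mapping.keys a \<subseteq> {i} \<and> Poly_Mapping.lookup a i = 0 \<longleftrightarrow> a = 0"
    using keys_subset_single[of a i] by auto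
  then show "mvps_coeff (mvps_of_fps i (fps_const c)) a = mvps_coeff (mvps_const c) a"
    by (auto simp: mvps_of_fps_def mvps_const.rep_eq)
qed

lemma mvps_of_fps_X: "mvps_of_fps i fps_X = (mvps_var i :: 'r::comm_ring_1 mvps)"
proof (rule mvps_eqI)
  fix a :: "nat \<Rightarrow>\<^sub>0 nat"
  have "Poly_Mapping.keys a \<subseteq> {i} \<and> Poly_Mapping.lookup a i = 1 \<longleftrightarrow> a = Poly_Mapping.single i 1"
    using keys_subset_single[of a i] by auto
  then show "mvps_coeff (mvps_of_fps i fps_X) a = mvps_coeff (mvps_var i :: 'r mvps) a"
    by (auto simp: mvps_of_fps_def mvps_var.rep_eq fps_X_def)
qed

lemma mvps_of_fps_diff: "mvps_of_fps i (f - g) = mvps_of_fps i f - mvps_of_fps i g"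
  by (rule mvps_eqI) (simp add: mvps_of_fps_def minus_mvps.rep_eq)

lemma mvps_of_fps_1: "mvps_of_fps i 1 = (1 :: 'r::comm_ring_1 mvps)"
proof -
  have "mvps_const 1 = (1 :: 'r mvps)"
    by (rule mvps_eqI) (simp add: mvps_const.rep_eq one_mvps.rep_eq)
  then show ?thesis using mvps_of_fps_const[of i "1 :: 'r"] by simp
qed

lemma mvps_of_fps_prod: "mvps_of_fps i (prod f A) = (\<Prod>x\<in>A. mvps_of_fps i (f x))"
  by (induction A rule: infinite_finite_induct) (simp_all add: mvps_of_fps_1 mvps_of_fps_times)

lemma mvps_of_fps_power: "mvps_of_fps i (f ^ n) = mvps_of_fps i f ^ n"
  by (induction n) (simp_all add: mvps_of_fps_1 mvps_of_fps_times)

text \<open>\<open>mvps_of_fps i\<close> is multiplicative, so an inverse in one variable stays an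
  inverse.\<close>

lemma inverse_one_minus_const_times_var:
  "inverse (1 - mvps_const c * mvps_var i) = mvps_of_fps i (geometric c)"
proof (rule mvps_inverse_eqI)
  have "(1 - mvps_const c * mvps_var i) * mvps_of_fps i (geometric c) =
    mvps_of_fps i ((1 - fps_const c * fps_X) * geometric c)"
    by (simp add: mvps_of_fps_times mvps_of_fps_diff mvps_of_fps_1 mvps_of_fps_const mvps_of_fps_X)
  then show "(1 - mvps_const c * mvps_var i) * mvps_of_fps i (geometric c) = 1"
    by (simp only: geometric_inverse mvps_of_fps_1)
qed

text \<open>As \<open>f\<close> does not involve y_i, the whole i-th exponent comes from the second
  factor; this leaves a single splitting of \<open>a\<close>.\<close>

lemma mvps_coeff_times_of_fps:
  assumes "\<And>b. Poly_Mapping.lookup b i \<noteq> 0 \<Longrightarrow> mvps_coeff f b = 0"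
  shows "mvps_coeff (f * mvps_of_fps i g) a =
    mvps_coeff f (Poly_Mapping.update i 0 a) * g $ Poly_Mapping.lookup a i"
proof -
  let ?b = "Poly_Mapping.update i 0 a" and ?c = "Poly_Mapping.single i (Poly_Mapping.lookup a i)"
  have bc: "?b + ?c = a"
    by (rule poly_mapping_eqI) (simp add: lookup_add lookup_update lookup_single when_def)
  have "mvps_coeff f b * mvps_coeff (mvps_of_fps i g) c = 0" if "b + c = a" "(b, c) \<noteq> (?b, ?c)" for b c
  proof (rule ccontr)
    assume "mvps_coeff f b * mvps_coeff (mvps_of_fps i g) c \<noteq> 0"
    then have b: "Poly_Mapping.lookup b i = 0" and c: "Poly_Mapping.keys c \<subseteq> {i}"
      using assms[of b] by (cases "Poly_Mapping.lookup b i = 0"; auto simp: mvps_of_fps_def split: if_splits)+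
    then have "Poly_Mapping.lookup a i = Poly_Mapping.lookup c i" using that(1) by (auto simp: lookup_add)
    then have "c = ?c" using keys_subset_single[OF c] by simp
    then show False using that bc by (metis add_right_cancel)
  qed
  then have "mvps_coeff (f * mvps_of_fps i g) a = (\<Sum>(b, c)\<in>{(?b, ?c)}. mvps_coeff f b * mvps_coeff (mvps_of_fps i g) c)"
    unfolding mvps_coeff_times
    by (intro sum.mono_neutral_right finite_exp_splits) (use bc in \<open>auto simp: exp_splits_def\<close>)
  then show ?thesis by (simp add: mvps_of_fps_def)
qed

lemma keys_update_0: "Poly_Mapping.keys (Poly_Mapping.update i 0 a) = Poly_Mapping.keys a - {i}"
  by (auto simp: in_keys_iff lookup_update split: if_splits)

lemma mvps_coeff_prod_of_fps:
  "mvps_coeff (\<Prod>i\<in>{1..k}. mvps_of_fps i f) a =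
    (if Poly_Mapping.keys a \<subseteq> {1..k} then \<Prod>i = 1..k. f $ Poly_Mapping.lookup a i else 0)"
proof (induction k arbitrary: a)
  case 0
  then show ?case by (auto simp: one_mvps.rep_eq)
next
  case (Suc k)
  have "mvps_coeff (\<Prod>i\<in>{1..k}. mvps_of_fps i f) b = 0" if "Poly_Mapping.lookup b (Suc k) \<noteq> 0" for b
  proof -
    have "Suc k \<in> Poly_Mapping.keys b" using that by (simp add: in_keys_iff)
    then have "\<not> Poly_Mapping.keys b \<subseteq> {1..k}" by auto
    then show ?thesis by (simp only: Suc.IH if_False)
  qed
  then have "mvps_coeff (\<Prod>i\<in>{1..Suc k}. mvps_of_fps i f) a =
    mvps_coeff (\<Prod>i\<in>{1..k}. mvps_of_fps i f) (Poly_Mapping.update (Suc k) 0 a) * f $ Poly_Mapping.lookup a (Suc k)"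
    using mvps_coeff_times_of_fps[of "Suc k" "\<Prod>i\<in>{1..k}. mvps_of_fps i f" f a] by simp
  moreover have "Poly_Mapping.keys a - {Suc k} \<subseteq> {1..k} \<longleftrightarrow> Poly_Mapping.keys a \<subseteq> {1..Suc k}"
    by (auto simp: atLeastAtMostSuc_conv)
  moreover have "(\<Prod>i = 1..k. f $ Poly_Mapping.lookup (Poly_Mapping.update (Suc k) 0 a) i) = (\<Prod>i = 1..k. f $ Poly_Mapping.lookup a i)"
    by (rule prod.cong) (auto simp: lookup_update)
  ultimately show ?case unfolding Suc.IH keys_update_0 by simp
qed

text \<open>The coefficient is a Kostka number: peeling off the largest entry repeatedly turns
  tableaux of content e into chains of horizontal strips with \<open>e i\<close> boxes in the i-th
  strip.\<close>

lemma mvps_coeff_schur: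
  assumes "shape a"
  shows "mvps_coeff (tableau_sum {1..k} (\<lambda>_ _. True) mvps_var a :: 'r::comm_ring_1 mvps) e =
    (if Poly_Mapping.keys e \<subseteq> {1..k}
     then of_nat (walks strip_kernel (\<lambda>_. 0) (Poly_Mapping.lookup e) k a) else 0)"
  using assms
proof (induction k arbitrary: a e)
  case 0
  then show ?case by (auto simp: tableau_sum_empty unit_shape_def one_mvps.rep_eq zero_mvps.rep_eq)
next
  case (Suc k)
  let ?t = "\<lambda>k. tableau_sum {1..k} (\<lambda>_ _. True) mvps_var :: _ \<Rightarrow> 'r mvps"
  let ?e = "Poly_Mapping.update (Suc k) 0 e" and ?n = "Poly_Mapping.lookup e (Suc k)"
  let ?w = "\<lambda>e. walks strip_kernel (\<lambda>_. 0) (Poly_Mapping.lookup e)"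
  have sb: "shape b" if "interlace a b" for b using that Suc.prems interlace_shape by blast
  have w: "?w ?e k = ?w e k" by (rule walks_cong) (auto simp: lookup_update)
  have keys: "Poly_Mapping.keys ?e \<subseteq> {1..k} \<longleftrightarrow> Poly_Mapping.keys e \<subseteq> {1..Suc k}"
    by (auto simp: keys_update_0 atLeastAtMostSuc_conv)
  have ins: "{1..Suc k} = insert (Suc k) {1..k}" by auto
  have "?t (Suc k) a = strip_down (mvps_var (Suc k)) (?t k) a"
    unfolding ins
    by (rule tableau_sum_insert_strip_down) (use Suc.prems in auto)
  then have "mvps_coeff (?t (Suc k) a) e =
      (\<Sum>b | interlace a b. mvps_coeff (?t k b * mvps_of_fps (Suc k) (fps_X ^ (boxes a - boxes b))) e)"
    by (simp add: strip_down_def mvps_coeff_sum mvps_of_fps_power mvps_of_fps_X mult.commute)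
  also have "\<dots> = (\<Sum>b | interlace a b. if boxes a = boxes b + ?n then
      (if Poly_Mapping.keys e \<subseteq> {1..Suc k} then of_nat (?w e k b) else 0) else 0)"
  proof (rule sum.cong[OF refl])
    fix b assume "b \<in> {b. interlace a b}"
    then have b: "shape b" "boxes b \<le> boxes a" using sb interlace_boxes_le Suc.prems by auto
    have "mvps_coeff (?t k b) d = 0" if "Poly_Mapping.lookup d (Suc k) \<noteq> 0" for d
    proof -
      have "Suc k \<in> Poly_Mapping.keys d" using that by (simp add: in_keys_iff)
      then have "\<not> Poly_Mapping.keys d \<subseteq> {1..k}" by auto
      then show ?thesis by (simp only: Suc.IH[OF b(1)] if_False)
    qed
    then have "mvps_coeff (?t k b * mvps_of_fps (Suc k) (fps_X ^ (boxes a - boxes b))) e =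
      mvps_coeff (?t k b) ?e * (fps_X ^ (boxes a - boxes b)) $ ?n"
      by (rule mvps_coeff_times_of_fps)
    also have "\<dots> = (if boxes a = boxes b + ?n then
      (if Poly_Mapping.keys e \<subseteq> {1..Suc k} then of_nat (?w e k b) else 0) else 0)"
      using b(2) unfolding Suc.IH[OF b(1)] keys w by (auto simp: fps_X_power_nth)
    finally show "mvps_coeff (?t k b * mvps_of_fps (Suc k) (fps_X ^ (boxes a - boxes b))) e = \<dots>" .
  qed
  also have "\<dots> = (\<Sum>b | interlace a b \<and> boxes a = boxes b + ?n.
      if Poly_Mapping.keys e \<subseteq> {1..Suc k} then of_nat (?w e k b) else 0)"
    by (rule sum.mono_neutral_cong_right[OF finite_interlace_lower[OF Suc.prems]]) auto
  also have "\<dots> = (if Poly_Mapping.keys e \<subseteq> {1..Suc k} then of_nat (?w e (Suc k) a) else 0)"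
  proof -
    have "{b. strip_kernel ?n a b \<noteq> 0} = {b. interlace a b \<and> boxes a = boxes b + ?n}"
      using Suc.prems by (auto simp: strip_kernel_def)
    moreover have "strip_kernel ?n a b = 1" if "interlace a b \<and> boxes a = boxes b + ?n" for b
      using that Suc.prems by (simp add: strip_kernel_def)
    ultimately show ?thesis by simp
  qed
  finally show ?case .
qed

text \<open>Convergence means that each coefficient is eventually constant, and past the finite set
  of terms contributing to it a coefficient no longer changes.\<close>

lemma mvps_has_sumI:
  fixes f :: "'b \<Rightarrow> 'r::comm_ring_1 mvps"
  assumes "\<And>e. finite {x \<in> A. mvps_coeff (f x) e \<noteq> 0}"
    and "\<And>e. (\<Sum>x | x \<in> A \<and> mvps_coeff (f x) e \<noteq> 0. mvps_coeff (f x) e) = mvps_coeff S e"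
  shows "(f has_sum S) A"
  unfolding has_sum_def tendsto_mvps_iff eventually_finite_subsets_at_top mvps_coeff_sum
proof (intro allI exI conjI impI)
  fix e Y
  show "finite {x \<in> A. mvps_coeff (f x) e \<noteq> 0}" by (rule assms)
  show "{x \<in> A. mvps_coeff (f x) e \<noteq> 0} \<subseteq> A" by blast
  assume Y: "finite Y \<and> {x \<in> A. mvps_coeff (f x) e \<noteq> 0} \<subseteq> Y \<and> Y \<subseteq> A"
  show "(\<Sum>x\<in>Y. mvps_coeff (f x) e) = mvps_coeff S e"
    unfolding assms(2)[symmetric] by (rule sum.mono_neutral_right) (use Y in auto)
qed

lemma mvps_coeff_const_times: "mvps_coeff (mvps_const c * f) e = c * mvps_coeff f e"
proof -
  have "mvps_coeff (mvps_const c * f) e = (\<Sum>(b, d)\<in>{(0, e)}. mvps_coeff (mvps_const c) b * mvps_coeff f d)"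
    unfolding mvps_coeff_times
    by (rule sum.mono_neutral_right) (auto simp: finite_exp_splits mvps_const.rep_eq, auto simp: exp_splits_def split: if_splits)
  then show ?thesis by (simp add: mvps_const.rep_eq)
qed

section \<open>Partitions as lists\<close>

definition parts :: "partition \<Rightarrow> nat \<Rightarrow> nat" where
  "parts la i = (if i < length la then la ! i else 0)"

lemma diagram_eq_young: "diagram la = young (parts la)"
  by (auto simp: diagram_def young_def parts_def split: if_splits)

lemma parts_in_shapes:
  assumes "is_partition la"
  shows "parts la \<in> shapes k \<longleftrightarrow> length la \<le> k"
proof -
  have pos: "0 < la ! i" if "i < length la" for i
    using assms that by (auto simp: is_partition_def)
  have "la ! Suc i \<le> la ! i" if "Suc i < length la" for i
    using assms that by (auto simp: is_partition_def sorted_wrt_iff_nth_less)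
  then have "antimono (parts la)" by (auto simp: antimono_iff_le_Suc parts_def)
  then show ?thesis using pos[of k] by (auto simp: shapes_def parts_def)
qed

text \<open>Positivity of the parts makes the length recoverable: by \<open>parts_in_shapes\<close>,
  the row function determines which k bound it.\<close>

lemma inj_on_parts: "inj_on parts {la. is_partition la}"
proof (rule inj_onI, clarify)
  fix la mu assume p: "is_partition la" "is_partition mu" and eq: "parts la = parts mu"
  have "length la \<le> k \<longleftrightarrow> length mu \<le> k" for k
    using parts_in_shapes[OF p(1), of k] parts_in_shapes[OF p(2), of k] eq by simp
  then have len: "length la = length mu" by (metis order_antisym order_refl)
  show "la = mu"
  proof (rule nth_equalityI[OF len])
    fix i assume "i < length la"
    then show "la ! i = mu ! i" using fun_cong[OF eq, of i] len by (simp add: parts_def)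
  qed
qed

lemma parts_surj:
  assumes "shape a"
  obtains la where "is_partition la" "parts la = a"
proof -
  obtain k where k: "a \<in> shapes k" using assms by (auto simp: shape_def)
  \<comment> \<open>The first empty row gives the number of parts.\<close>
  define m where "m = (LEAST i. a i = 0)"
  have "a k = 0" using k by (simp add: shapes_def)
  then have am: "a m = 0" unfolding m_def by (rule LeastI)
  have anti: "a j \<le> a i" if "i \<le> j" for i j using k that by (auto simp: shapes_def antimono_def)
  have pos: "0 < a i" if "i < m" for i using not_less_Least[of i "\<lambda>i. a i = 0"] that by (auto simp: m_def)
  have "is_partition (map a [0..<m])"
    using anti pos by (auto simp: is_partition_def sorted_wrt_iff_nth_less)
  moreover have "parts (map a [0..<m]) = a"
    using am anti[of m] by (auto simp: parts_def fun_eq_iff not_less)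
  ultimately show ?thesis by (rule that)
qed

lemma bij_betw_parts: "bij_betw parts {la. is_partition la \<and> length la \<le> k} (shapes k)"
proof (rule bij_betw_imageI)
  show "inj_on parts {la. is_partition la \<and> length la \<le> k}"
    by (rule inj_on_subset[OF inj_on_parts]) auto
  show "parts ` {la. is_partition la \<and> length la \<le> k} = shapes k"
  proof (intro equalityI subsetI)
    fix a assume a: "a \<in> shapes k"
    then obtain la where "is_partition la" "parts la = a" using parts_surj shapes_shape by blast
    then show "a \<in> parts ` {la. is_partition la \<and> length la \<le> k}" using a parts_in_shapes by blast
  qed (use parts_in_shapes in auto)
qed

lemma parts_shape: "is_partition la \<Longrightarrow> shape (parts la)"
  using parts_in_shapes shapes_shape by blast

lemma parts_Nil [simp]: "parts [] = (\<lambda>_. 0)"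
  by (simp add: parts_def fun_eq_iff)

lemma is_partition_Nil [simp]: "is_partition []"
  by (simp add: is_partition_def)

lemma parts_eq_zero_iff: "is_partition la \<Longrightarrow> parts la = (\<lambda>_. 0) \<longleftrightarrow> la = []"
  using parts_in_shapes[of la 0] by (auto simp: shapes_0_iff)

text \<open>If row i + 1 of \<open>la\<close> stuck out beyond row i of \<open>mu\<close>, its last
  column would contain skew boxes in both rows. Conversely, two skew boxes in one column violate the
  inequality at the upper one.\<close>

lemma horizontal_strip_iff_interlace:
  assumes "is_partition la" "is_partition mu"
  shows "horizontal_strip la mu \<longleftrightarrow> interlace (parts la) (parts mu)"
proof -
  define a b where "a = parts la" and "b = parts mu"
  have anti: "a j \<le> a i" "b j \<le> b i" if "i \<le> j" for i j
    using parts_shape[OF assms(1)] parts_shape[OF assms(2)] that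
    by (auto simp: a_def b_def shape_def shapes_def antimono_def)
  have "interlace a b" if hs: "horizontal_strip la mu"
    unfolding interlace_def
  proof
    fix i
    have sub: "young b \<subseteq> young a"
      and strip: "\<And>m m' n. (m, n) \<in> young a - young b \<Longrightarrow> (m', n) \<in> young a - young b \<Longrightarrow> m = m'"
      using hs unfolding horizontal_strip_def diagram_eq_young a_def b_def by blast+
    have "b i \<le> a i"
    proof (cases "b i = 0")
      case False
      then have "(Suc i, b i) \<in> young b" by (auto simp: young_def)
      then have "(Suc i, b i) \<in> young a" using sub by blast
      then show ?thesis by (simp add: young_def)
    qed simp
    moreover have "a (Suc i) \<le> b i"
    proof (rule ccontr)
      assume "\<not> a (Suc i) \<le> b i"
      then have "(Suc i, a (Suc i)) \<in> young a - young b" "(Suc (Suc i), a (Suc i)) \<in> young a - young b"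
        using anti(1)[of i "Suc i"] anti(2)[of i "Suc i"] by (auto simp: young_def)
      then show False using strip by fastforce
    qed
    ultimately show "b i \<le> a i \<and> a (Suc i) \<le> b i" ..
  qed
  moreover have "horizontal_strip la mu" if il: "interlace a b"
  proof -
    have sub: "young b \<subseteq> young a" by (rule young_mono) (use il in \<open>auto simp: interlace_def\<close>)
    have "\<not> m < m'" if "(m, n) \<in> young a - young b" "(m', n) \<in> young a - young b" for m m' n
    proof
      assume "m < m'"
      have n: "1 \<le> m" "b (m - 1) < n" "n \<le> a (m' - 1)" using that by (auto simp: young_def)
      have "a (m' - 1) \<le> a (Suc (m - 1))" using \<open>m < m'\<close> n by (intro anti) auto
      also have "\<dots> \<le> b (m - 1)" using il by (simp add: interlace_def)
      finally show False using n by simp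
    qed
    then show ?thesis using sub unfolding horizontal_strip_def diagram_eq_young a_def[symmetric] b_def[symmetric]
      by (metis linorder_neqE_nat)
  qed
  ultimately show ?thesis unfolding a_def b_def by blast
qed

lemma card_diagram_diff:
  assumes "is_partition la" "is_partition mu" "horizontal_strip la mu"
  shows "card (diagram la - diagram mu) = boxes (parts la) - boxes (parts mu)"
proof -
  have "finite (diagram mu)" using finite_young[OF parts_shape[OF assms(2)]] by (simp add: diagram_eq_young)
  then have "card (diagram la - diagram mu) = card (diagram la) - card (diagram mu)"
    using assms(3) by (intro card_Diff_subset) (auto simp: horizontal_strip_def)
  then show ?thesis
    using card_young[OF parts_shape[OF assms(1)]] card_young[OF parts_shape[OF assms(2)]]
    by (simp add: diagram_eq_young)
qed

lemma schur_eq_tableau_sum: "schur L v la = tableau_sum L (\<lambda>_ _. True) v (parts la)"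
  unfolding schur_def tableau_sum_def SSYT_def tableaux_def diagram_eq_young by simp

lemma sp_eq_king_sum: "sp k v la = king_sum k v (parts la)"
proof -
  have "KT k la = tableaux (barred_alphabet k) (\<lambda>m t. Plain m \<le> t) (parts la)"
    unfolding KT_def SSYT_def tableaux_def diagram_eq_young by auto
  then show ?thesis by (simp add: sp_def king_sum_def tableau_sum_def diagram_eq_young)
qed

section \<open>Counting oscillating tableaux\<close>

text \<open>Step \<open>i\<close> of the text has list index \<open>i - 1\<close>, so this is the shape reached after \<open>i\<close> steps.\<close>

definition shape_after :: "osc \<Rightarrow> nat \<Rightarrow> partition" where
  "shape_after S i = (if i = 0 then [] else snd (S ! (i - 1)))"

definition step_boxes :: "osc \<Rightarrow> nat \<Rightarrow> nat" where
  "step_boxes S i = card (deleted_boxes S i) + card (added_boxes S i)"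

definition osc_step :: "nat \<Rightarrow> partition \<Rightarrow> partition \<Rightarrow> partition \<Rightarrow> bool" where
  "osc_step n mu ka la \<longleftrightarrow> is_partition mu \<and> is_partition ka \<and> is_partition la \<and>
     horizontal_strip mu ka \<and> horizontal_strip la ka \<and>
     card (diagram mu - diagram ka) + card (diagram la - diagram ka) = n"

definition osc_paths :: "(nat \<Rightarrow> nat) \<Rightarrow> nat \<Rightarrow> partition \<Rightarrow> osc set" where
  "osc_paths g k la = {S. length S = k \<and> shape_after S k = la \<and>
     (\<forall>i<k. osc_step (g (Suc i)) (shape_after S i) (fst (S ! i)) (snd (S ! i)))}"

lemma osc_paths_0: "osc_paths g 0 la = (if la = [] then {[]} else {})"
  by (auto simp: osc_paths_def shape_after_def)

lemma osc_paths_Suc: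
  "bij_betw (\<lambda>((mu, ka), S). S @ [(ka, la)])
    (Sigma {(mu, ka). osc_step (g (Suc k)) mu ka la} (\<lambda>(mu, ka). osc_paths g k mu)) (osc_paths g (Suc k) la)"
proof -
  have after: "shape_after (S @ [p]) i = shape_after S i" if "i \<le> length S" for S p i
    using that by (auto simp: shape_after_def nth_append)
  show ?thesis
  proof (rule bij_betw_byWitness[where f' = "\<lambda>S. ((shape_after S k, fst (S ! k)), butlast S)"])
    show "\<forall>x\<in>Sigma {(mu, ka). osc_step (g (Suc k)) mu ka la} (\<lambda>(mu, ka). osc_paths g k mu).
        (\<lambda>S. ((shape_after S k, fst (S ! k)), butlast S)) ((\<lambda>((mu, ka), S). S @ [(ka, la)]) x) = x"
      by (auto simp: osc_paths_def after nth_append)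
    show "(\<lambda>((mu, ka), S). S @ [(ka, la)]) ` Sigma {(mu, ka). osc_step (g (Suc k)) mu ka la} (\<lambda>(mu, ka). osc_paths g k mu)
        \<subseteq> osc_paths g (Suc k) la"
      by (auto simp: osc_paths_def after nth_append less_Suc_eq) (simp add: shape_after_def nth_append)
    have S: "S = butlast S @ [(fst (S ! k), la)]" "length (butlast S) = k"
      "osc_step (g (Suc k)) (shape_after S k) (fst (S ! k)) la"
      "shape_after (butlast S) k = shape_after S k"
      "butlast S \<in> osc_paths g k (shape_after S k)"
      if S: "S \<in> osc_paths g (Suc k) la" for S
    proof -
      have len: "length S = Suc k" and la: "snd (S ! k) = la"
        using S by (auto simp: osc_paths_def shape_after_def)
      have "S \<noteq> []" using len by auto
      moreover from this have "last S = (fst (S ! k), la)" using len la by (simp add: last_conv_nth prod_eq_iff)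
      ultimately show eq: "S = butlast S @ [(fst (S ! k), la)]" by (metis append_butlast_last_id)
      show len': "length (butlast S) = k" using len by simp
      show "osc_step (g (Suc k)) (shape_after S k) (fst (S ! k)) la"
        using S la by (auto simp: osc_paths_def)
      have aft: "shape_after (butlast S) i = shape_after S i" if "i \<le> k" for i
        using that len by (auto simp: shape_after_def nth_butlast)
      then show "shape_after (butlast S) k = shape_after S k" by simp
      show "butlast S \<in> osc_paths g k (shape_after S k)"
        using S len' aft by (auto simp: osc_paths_def nth_butlast)
    qed
    show "\<forall>S\<in>osc_paths g (Suc k) la. (\<lambda>((mu, ka), S). S @ [(ka, la)]) ((\<lambda>S. ((shape_after S k, fst (S ! k)), butlast S)) S) = S"
      using S(1) by (metis (mono_tags, lifting) case_prod_conv)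
    show "(\<lambda>S. ((shape_after S k, fst (S ! k)), butlast S)) ` osc_paths g (Suc k) la
        \<subseteq> Sigma {(mu, ka). osc_step (g (Suc k)) mu ka la} (\<lambda>(mu, ka). osc_paths g k mu)"
      using S(3,5) by auto
  qed
qed

lemma osc_step_iff:
  "osc_step n mu ka la \<longleftrightarrow> is_partition mu \<and> is_partition ka \<and> is_partition la \<and>
     interlace (parts mu) (parts ka) \<and> interlace (parts la) (parts ka) \<and>
     boxes (parts mu) - boxes (parts ka) + (boxes (parts la) - boxes (parts ka)) = n"
  unfolding osc_step_def
  by (auto simp: horizontal_strip_iff_interlace card_diagram_diff)

text \<open>Splitting off the last step (\<open>osc_paths_Suc\<close>) mirrors the recursion of
  \<open>walks\<close>: \<open>parts\<close> matches the previous and the intermediate shape with a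
  pair (b, c), and the number of choices of c is the kernel value.\<close>

lemma card_osc_paths:
  assumes "is_partition la"
  shows "finite (osc_paths g k la) \<and> card (osc_paths g k la) = walks osc_kernel (\<lambda>_. 0) g k (parts la)"
  using assms
proof (induction k arbitrary: la)
  case 0
  then show ?case by (simp add: osc_paths_0 parts_eq_zero_iff)
next
  case (Suc k)
  let ?n = "g (Suc k)" and ?a = "parts la"
  let ?X = "{(mu, ka). osc_step ?n mu ka la}"
  let ?C = "\<lambda>b. {c. shape ?a \<and> interlace ?a c \<and> interlace b c \<and> (boxes b - boxes c) + (boxes ?a - boxes c) = ?n}"
  let ?B = "{b. osc_kernel ?n ?a b \<noteq> 0}"
  let ?Y = "Sigma ?B ?C"
  let ?w = "walks osc_kernel (\<lambda>_. 0) g"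
  have sa: "shape ?a" by (rule parts_shape[OF Suc.prems])
  have finB: "finite ?B"
    by (rule finite_subset[OF _ finite_shapes_bounded[of "boxes ?a + ?n"]]) (use osc_kernel_nonzeroD in blast)
  have finY: "finite ?Y" using finB finite_osc_kernel by blast
  have nonzero: "osc_kernel ?n ?a b \<noteq> 0" if "c \<in> ?C b" for b c
    unfolding osc_kernel_def card_eq_0_iff using finite_osc_kernel[of ?a b ?n] that by blast
  have bij: "bij_betw (map_prod parts parts) ?X ?Y"
  proof (rule bij_betw_imageI)
    show "inj_on (map_prod parts parts) ?X"
      using inj_on_parts by (auto simp: inj_on_def osc_step_def)
    show "map_prod parts parts ` ?X = ?Y"
    proof (intro equalityI subsetI)
      fix x assume "x \<in> map_prod parts parts ` ?X"
      then obtain mu ka where x: "x = (parts mu, parts ka)" and st: "osc_step ?n mu ka la" by auto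
      have "parts ka \<in> ?C (parts mu)" using st sa by (auto simp: osc_step_iff)
      then show "x \<in> ?Y" using nonzero x by blast
    next
      fix x assume "x \<in> ?Y"
      then obtain b c where x: "x = (b, c)" and c: "c \<in> ?C b" by blast
      then have "shape c" "shape b" using interlace_shape by blast+
      then obtain mu ka where mk: "is_partition mu" "parts mu = b" "is_partition ka" "parts ka = c"
        using parts_surj by metis
      then have "(mu, ka) \<in> ?X" using c Suc.prems by (auto simp: osc_step_iff)
      then show "x \<in> map_prod parts parts ` ?X" using x mk by force
    qed
  qed
  have finX: "finite ?X" using bij_betw_finite[OF bij] finY by simp
  have IH: "finite (osc_paths g k mu)" "card (osc_paths g k mu) = ?w k (parts mu)"
    if "(mu, ka) \<in> ?X" for mu ka
    using Suc.IH[of mu] that by (auto simp: osc_step_def)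
  let ?S = "Sigma ?X (\<lambda>(mu, ka). osc_paths g k mu)"
  have fin: "finite ?S" using finX IH(1) by (intro finite_SigmaI) auto
  have "card ?S = (\<Sum>x\<in>?X. card (case x of (mu, ka) \<Rightarrow> osc_paths g k mu))"
    using IH(1) finX by (intro card_SigmaI) auto
  also have "\<dots> = (\<Sum>x\<in>?X. ?w k (fst (map_prod parts parts x)))"
    using IH(2) by (intro sum.cong) auto
  also have "\<dots> = (\<Sum>y\<in>?Y. ?w k (fst y))"
    by (rule sum.reindex_bij_betw[OF bij])
  also have "\<dots> = (\<Sum>b\<in>?B. \<Sum>c\<in>?C b. ?w k b)"
    using finB finite_osc_kernel by (subst sum.Sigma) (auto simp: case_prod_beta)
  also have "\<dots> = ?w (Suc k) ?a"
    by (simp add: osc_kernel_def)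
  finally have "card ?S = ?w (Suc k) ?a" .
  then show ?case
    using bij_betw_same_card[OF osc_paths_Suc] bij_betw_finite[OF osc_paths_Suc] fin by metis
qed

text \<open>In \<open>osc_paths\<close> every step, the first included, deletes and then adds. From
  \<open>[]\<close> a deletion can only lead to \<open>[]\<close>, which is the condition on the
  first inner shape in \<open>SSOT\<close>.\<close>

lemma SSOT_eq_osc_paths:
  assumes "k \<ge> 1"
  shows "{S \<in> SSOT k la. \<forall>i\<in>{1..k}. step_boxes S i = g i} = osc_paths g k la"
proof -
  have after0: "shape_after S 0 = []" for S by (simp add: shape_after_def)
  have outer: "outer_shape S i = shape_after S i" if "i \<ge> 1" for S i
    using that by (simp add: outer_shape_def shape_after_def)
  have inner: "inner_shape S (Suc i) = fst (S ! i)" for S i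
    by (simp add: inner_shape_def)
  have diag0: "diagram [] = {}" by (simp add: diagram_def)
  have empty: "mu = []" if "is_partition mu" "diagram mu = {}" for mu
    using parts_eq_zero_iff[OF that(1)] that(2) by (simp add: diagram_eq_young young_empty_iff)
  have hs0: "horizontal_strip [] mu \<longleftrightarrow> mu = []" if "is_partition mu" for mu
    using empty[OF that] by (auto simp: horizontal_strip_def diag0)
  have sb: "step_boxes S (Suc i) = card (diagram (shape_after S i) - diagram (fst (S ! i))) +
      card (diagram (snd (S ! i)) - diagram (fst (S ! i)))" for S i
    by (cases i) (simp_all add: step_boxes_def deleted_boxes_def added_boxes_def outer inner after0 diag0
        shape_after_def[of _ "Suc _"])
  have all: "(\<forall>i\<in>{1..k}. P i) \<longleftrightarrow> (\<forall>i<k. P (Suc i))" for P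
    by (metis One_nat_def Suc_le_eq atLeastAtMost_iff le_add1 plus_1_eq_Suc Suc_pred less_Suc_eq_le)
  have snd: "snd (S ! i) = shape_after S (Suc i)" for S i by (simp add: shape_after_def)
  have all': "(\<forall>i\<in>{1..k-1}. P i) \<longleftrightarrow> (\<forall>i<k. i \<noteq> 0 \<longrightarrow> P i)" for P
    using assms by auto
  show ?thesis
  proof (intro set_eqI iffI)
    fix S assume S: "S \<in> {S \<in> SSOT k la. \<forall>i\<in>{1..k}. step_boxes S i = g i}"
    then have len: "length S = k" and last: "shape_after S k = la" and in1: "fst (S ! 0) = []"
      and part: "\<And>i. i < k \<Longrightarrow> is_partition (fst (S ! i)) \<and> is_partition (shape_after S (Suc i))"
      and hs: "\<And>i. i < k \<Longrightarrow> i \<noteq> 0 \<Longrightarrow> horizontal_strip (shape_after S i) (fst (S ! i))"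
      and hs': "\<And>i. i < k \<Longrightarrow> horizontal_strip (shape_after S (Suc i)) (fst (S ! i))"
      and sz: "\<And>i. i < k \<Longrightarrow> step_boxes S (Suc i) = g (Suc i)"
      using assms unfolding SSOT_def all all' by (auto simp: outer inner inner[of _ 0, simplified])
    have pa: "is_partition (shape_after S i)" if "i < k" for i
      using part[of "i - 1"] that by (cases i) (auto simp: after0)
    have "horizontal_strip (shape_after S i) (fst (S ! i))" if "i < k" for i
      using hs[OF that] in1 by (cases i) (auto simp: after0 hs0)
    then show "S \<in> osc_paths g k la"
      using len last part pa hs' sz unfolding osc_paths_def osc_step_def sb by (auto simp: snd)
  next
    fix S assume S: "S \<in> osc_paths g k la"
    then have st: "osc_step (g (Suc i)) (shape_after S i) (fst (S ! i)) (shape_after S (Suc i))" if "i < k" for i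
      using that by (simp add: osc_paths_def snd)
    have in1: "fst (S ! 0) = []" using st[of 0] assms hs0 by (auto simp: osc_step_def after0)
    show "S \<in> {S \<in> SSOT k la. \<forall>i\<in>{1..k}. step_boxes S i = g i}"
      using S st assms in1 unfolding SSOT_def mem_Collect_eq all all' sb
      by (auto simp: outer inner inner[of _ 0, simplified] osc_step_def osc_paths_def snd)
  qed
qed

section \<open>Weights of oscillating tableaux as monomials\<close>

definition mvps_monom :: "(nat \<Rightarrow>\<^sub>0 nat) \<Rightarrow> 'r::comm_ring_1 mvps" where
  "mvps_monom a = Abs_mvps (\<lambda>b. if b = a then 1 else 0)"

lemma mvps_monom_times: "mvps_monom a * mvps_monom b = (mvps_monom (a + b) :: 'r::comm_ring_1 mvps)"
proof (rule mvps_eqI)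
  fix e
  have "mvps_coeff (mvps_monom a * mvps_monom b :: 'r mvps) e =
    (\<Sum>x\<in>exp_splits e. if x = (a, b) then 1 else 0)"
    unfolding mvps_coeff_times by (rule sum.cong) (auto simp: mvps_monom_def split: if_splits)
  also have "\<dots> = mvps_coeff (mvps_monom (a + b)) e"
    by (subst sum.delta[OF finite_exp_splits]) (auto simp: exp_splits_def mvps_monom_def)
  finally show "mvps_coeff (mvps_monom a * mvps_monom b :: 'r mvps) e = mvps_coeff (mvps_monom (a + b)) e" .
qed

lemma mvps_monom_0: "mvps_monom 0 = 1"
  by (rule mvps_eqI) (simp add: mvps_monom_def one_mvps.rep_eq)

lemma mvps_var_eq_monom: "mvps_var i = mvps_monom (Poly_Mapping.single i 1)"
  by (rule mvps_eqI) (simp add: mvps_monom_def mvps_var.rep_eq)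

lemma prod_mvps_monom: "(\<Prod>x\<in>A. mvps_monom (f x)) = mvps_monom (\<Sum>x\<in>A. f x)"
  by (induction A rule: infinite_finite_induct) (simp_all add: mvps_monom_0 mvps_monom_times)

lemma prod_mset_mvps_var:
  "(\<Prod>j\<in>#M. mvps_var j) = mvps_monom (\<Sum>j\<in>#M. Poly_Mapping.single j 1)"
  by (induction M) (simp_all add: mvps_monom_0 mvps_monom_times mvps_var_eq_monom)

lemma lookup_sum_mset_single:
  "Poly_Mapping.lookup (\<Sum>j\<in>#M. Poly_Mapping.single j 1) i = count M i"
  by (induction M) (simp_all add: lookup_add lookup_single when_def)

text \<open>The weight is a single monomial, and double counting of boxes and entries gives
  \<open>step_boxes S i\<close> as its exponent of y_i.\<close>

lemma mvps_coeff_osc_weight: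
  assumes S: "S \<in> SSOT k la"
  shows "mvps_coeff (osc_weight S) e =
    (if Poly_Mapping.keys e \<subseteq> {1..k} \<and> (\<forall>i\<in>{1..k}. step_boxes S i = Poly_Mapping.lookup e i) then 1 else 0)"
proof -
  let ?D = "\<Union>i\<in>{1..length S}. diagram (outer_shape S i)"
  define w where "w = (\<Sum>b\<in>?D. \<Sum>j\<in>#osc_entries S b. Poly_Mapping.single j (1::nat))"
  have len: "length S = k" and part: "\<And>i. i \<in> {1..k} \<Longrightarrow> is_partition (outer_shape S i)"
    using S by (auto simp: SSOT_def)
  have finD: "finite ?D"
    using part len parts_shape finite_young by (auto simp: diagram_eq_young)
  have lookup: "Poly_Mapping.lookup w i = (if i \<in> {1..k} then step_boxes S i else 0)" for i
  proof -
    have "Poly_Mapping.lookup w i = (\<Sum>b\<in>?D. count (osc_entries S b) i)"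
      unfolding w_def lookup_sum lookup_sum_mset_single ..
    also have "\<dots> = (\<Sum>b\<in>?D. (if i \<in> {1..k} \<and> b \<in> deleted_boxes S i then 1 else 0) +
        (if i \<in> {1..k} \<and> b \<in> added_boxes S i then 1 else 0))"
      by (rule sum.cong) (simp_all add: osc_entries_def count_mset_set' len)
    also have "\<dots> = (if i \<in> {1..k} then step_boxes S i else 0)"
    proof (cases "i \<in> {1..k}")
      case True
      \<comment> \<open>Deleted boxes lie in the previous outer shape and added ones in the current
        outer shape, so the box set of \<open>osc_weight\<close> misses none.\<close>
      have "deleted_boxes S i \<subseteq> ?D" "added_boxes S i \<subseteq> ?D"
        using True len by (force simp: deleted_boxes_def added_boxes_def split: if_splits)+
      moreover have "(\<Sum>b\<in>?D. if b \<in> X then 1 else 0 :: nat) = card X" if "X \<subseteq> ?D" for X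
      proof -
        have "(\<Sum>b\<in>?D. if b \<in> X then 1 else 0 :: nat) = (\<Sum>b\<in>X. 1)"
          by (rule sum.mono_neutral_cong_right) (use finD that in auto)
        then show ?thesis by simp
      qed
      ultimately show ?thesis using True by (simp only: sum.distrib step_boxes_def simp_thms if_True)
    qed auto
    finally show ?thesis .
  qed
  have "osc_weight S = (mvps_monom w :: 'a mvps)"
    unfolding osc_weight_def prod_mset_mvps_var prod_mvps_monom w_def ..
  moreover have "e = w \<longleftrightarrow> Poly_Mapping.keys e \<subseteq> {1..k} \<and> (\<forall>i\<in>{1..k}. step_boxes S i = Poly_Mapping.lookup e i)"
  proof
    assume e: "e = w"
    show "Poly_Mapping.keys e \<subseteq> {1..k} \<and> (\<forall>i\<in>{1..k}. step_boxes S i = Poly_Mapping.lookup e i)"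
      unfolding e by (auto simp: in_keys_iff lookup split: if_splits)
  next
    assume e: "Poly_Mapping.keys e \<subseteq> {1..k} \<and> (\<forall>i\<in>{1..k}. step_boxes S i = Poly_Mapping.lookup e i)"
    show "e = w"
    proof (rule poly_mapping_eqI)
      fix i
      show "Poly_Mapping.lookup e i = Poly_Mapping.lookup w i"
        unfolding lookup using e by (cases "i \<in> {1..k}") (auto simp: in_keys_iff subset_iff)
    qed
  qed
  ultimately show ?thesis by (simp add: mvps_monom_def)
qed

text \<open>The sum over tableaux may be infinite, but an exponent vector prescribes the size of
  every step, and then only the finitely many \<open>osc_paths\<close> contribute.\<close>

lemma mvps_coeff_ss:
  assumes la: "is_partition la" and k: "k \<ge> 1"
  shows "mvps_coeff (ss k la :: 'r::comm_ring_1 mvps) e =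
    (if Poly_Mapping.keys e \<subseteq> {1..k}
     then of_nat (walks osc_kernel (\<lambda>_. 0) (Poly_Mapping.lookup e) k (parts la)) else 0)"
proof -
  let ?c = "\<lambda>e. if Poly_Mapping.keys e \<subseteq> {1..k}
     then of_nat (walks osc_kernel (\<lambda>_. 0) (Poly_Mapping.lookup e) k (parts la)) else (0 :: 'r)"
  have supp: "{S \<in> SSOT k la. mvps_coeff (osc_weight S :: 'r mvps) e \<noteq> 0} =
      (if Poly_Mapping.keys e \<subseteq> {1..k} then osc_paths (Poly_Mapping.lookup e) k la else {})" for e
    unfolding SSOT_eq_osc_paths[OF k, symmetric]
    by (auto simp: mvps_coeff_osc_weight split: if_splits)
  have "(osc_weight has_sum Abs_mvps ?c) (SSOT k la)"
  proof (rule mvps_has_sumI)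
    fix e
    show "finite {S \<in> SSOT k la. mvps_coeff (osc_weight S :: 'r mvps) e \<noteq> 0}"
      unfolding supp using card_osc_paths[OF la] by auto
    have "(\<Sum>S | S \<in> SSOT k la \<and> mvps_coeff (osc_weight S :: 'r mvps) e \<noteq> 0. mvps_coeff (osc_weight S :: 'r mvps) e) =
      (\<Sum>S | S \<in> SSOT k la \<and> mvps_coeff (osc_weight S :: 'r mvps) e \<noteq> 0. 1)"
      by (rule sum.cong) (auto simp: mvps_coeff_osc_weight split: if_splits)
    also have "\<dots> = mvps_coeff (Abs_mvps ?c) e"
      unfolding supp using card_osc_paths[OF la] by auto
    finally show "(\<Sum>S | S \<in> SSOT k la \<and> mvps_coeff (osc_weight S :: 'r mvps) e \<noteq> 0. mvps_coeff (osc_weight S :: 'r mvps) e) =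
      mvps_coeff (Abs_mvps ?c) e" .
  qed
  then have "ss k la = Abs_mvps ?c" unfolding ss_def by (rule infsumI)
  then show ?thesis by simp
qed

section \<open>Summation over partitions and the two expansions\<close>

lemma has_sum_over_partitions:
  fixes s :: "(nat \<Rightarrow> nat) \<Rightarrow> 'r::comm_ring_1"
  assumes F: "\<And>la e. is_partition la \<Longrightarrow> mvps_coeff (F la) e =
      (if Poly_Mapping.keys e \<subseteq> {1..k} then of_nat (w (Poly_Mapping.lookup e) (parts la)) else 0)"
    and fin: "\<And>g. finite {a. w g a \<noteq> 0}" and sub: "\<And>g. {a. w g a \<noteq> 0} \<subseteq> shapes k"
    and total: "\<And>g. (\<Sum>a | w g a \<noteq> 0. of_nat (w g a) * s a) = (\<Prod>i = 1..k. h $ g i)"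
  shows "((\<lambda>la. mvps_const (s (parts la)) * F la) has_sum (\<Prod>i\<in>{1..k}. mvps_of_fps i h))
    {la. is_partition la \<and> length la \<le> k}"
proof (rule mvps_has_sumI)
  fix e
  let ?P = "{la. is_partition la \<and> length la \<le> k}"
  let ?f = "\<lambda>la. mvps_coeff (mvps_const (s (parts la)) * F la) e"
  let ?w = "w (Poly_Mapping.lookup e)"
  \<comment> \<open>\<open>Z\<close> may exceed the support of \<open>?f\<close>, since
    \<open>s\<close> can vanish, but it is \<open>Z\<close> that \<open>parts\<close> maps
    bijectively onto the index set of \<open>total\<close>.\<close>
  define Z where "Z = {la \<in> ?P. ?w (parts la) \<noteq> 0}"
  have bij: "bij_betw parts Z {a. ?w a \<noteq> 0}"
  proof (rule bij_betw_subset[OF bij_betw_parts[of k]])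
    show "Z \<subseteq> ?P" by (auto simp: Z_def)
    show "parts ` Z = {a. ?w a \<noteq> 0}"
    proof (intro equalityI subsetI)
      fix a assume a: "a \<in> {a. ?w a \<noteq> 0}"
      then have "a \<in> parts ` ?P" using sub bij_betw_imp_surj_on[OF bij_betw_parts[of k]] by blast
      then show "a \<in> parts ` Z" using a by (auto simp: Z_def)
    qed (auto simp: Z_def)
  qed
  then have finZ: "finite Z" using bij_betw_finite[OF bij] fin by simp
  have f: "?f la = (if Poly_Mapping.keys e \<subseteq> {1..k} then of_nat (?w (parts la)) * s (parts la) else 0)"
    if "la \<in> ?P" for la
    unfolding mvps_coeff_const_times using F[of la e] that by (simp add: mult.commute)
  have supp: "{la \<in> ?P. ?f la \<noteq> 0} \<subseteq> Z"
  proof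
    fix la assume "la \<in> {la \<in> ?P. ?f la \<noteq> 0}"
    then show "la \<in> Z" using f[of la] by (cases "?w (parts la) = 0") (auto simp: Z_def split: if_splits)
  qed
  show "finite {la \<in> ?P. ?f la \<noteq> 0}" by (rule finite_subset[OF supp finZ])
  have "(\<Sum>la | la \<in> ?P \<and> ?f la \<noteq> 0. ?f la) = (\<Sum>la\<in>Z. ?f la)"
    by (rule sum.mono_neutral_left[OF finZ supp]) (auto simp: Z_def)
  also have "\<dots> = (\<Sum>la\<in>Z. if Poly_Mapping.keys e \<subseteq> {1..k} then of_nat (?w (parts la)) * s (parts la) else 0)"
    by (rule sum.cong) (use f in \<open>auto simp: Z_def\<close>)
  also have "\<dots> = (\<Sum>a | ?w a \<noteq> 0. if Poly_Mapping.keys e \<subseteq> {1..k} then of_nat (?w a) * s a else 0)"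
    by (rule sum.reindex_bij_betw[OF bij])
  also have "\<dots> = mvps_coeff (\<Prod>i\<in>{1..k}. mvps_of_fps i h) e"
    unfolding mvps_coeff_prod_of_fps using total[of "Poly_Mapping.lookup e"] by simp
  finally show "(\<Sum>la | la \<in> ?P \<and> ?f la \<noteq> 0. ?f la) = mvps_coeff (\<Prod>i\<in>{1..k}. mvps_of_fps i h) e" .
qed

lemma x_var_inverse: "x_var (Plain j) * x_var (Barred j) = 1"
  by (simp add: mult_single single_add[symmetric] flip: single_one)

theorem corollary4p23:
  fixes k :: nat
  assumes "k \<ge> 1"
  shows
    "((\<lambda>la. mvps_const (schur (barred_alphabet k) x_var la) * schur {1..k} mvps_var la)
        has_sum
      (\<Prod>i\<in>{1..k}. \<Prod>j\<in>{1..k}.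
          inverse (1 - mvps_const (x_var (Plain j)) * mvps_var i) *
          inverse (1 - mvps_const (x_var (Barred j)) * mvps_var i)))
      {la. is_partition la \<and> length la \<le> k}
   \<and> ((\<lambda>la. mvps_const (sp k x_var la) * ss k la)
        has_sum
      (\<Prod>i\<in>{1..k}. \<Prod>j\<in>{1..k}.
          inverse (1 - mvps_const (x_var (Plain j)) * mvps_var i) *
          inverse (1 - mvps_const (x_var (Barred j)) * mvps_var i)))
      {la. is_partition la \<and> length la \<le> k}"
proof -
  define h where "h = (\<Prod>j = 1..k. geometric (x_var (Plain j)) * geometric (x_var (Barred j)))"
  have prod: "(\<Prod>i\<in>{1..k}. \<Prod>j\<in>{1..k}.
          inverse (1 - mvps_const (x_var (Plain j)) * mvps_var i) *
          inverse (1 - mvps_const (x_var (Barred j)) * mvps_var i)) = (\<Prod>i\<in>{1..k}. mvps_of_fps i h)"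
    unfolding h_def by (simp only: inverse_one_minus_const_times_var mvps_of_fps_prod mvps_of_fps_times)
  have fin: "finite (barred_alphabet k)" by (simp add: barred_alphabet_def)
  have "(\<Prod>t\<in>barred_alphabet k. geometric (x_var t)) =
      (\<Prod>t\<in>Plain ` {1..k}. geometric (x_var t)) * (\<Prod>t\<in>Barred ` {1..k}. geometric (x_var t))"
    unfolding barred_alphabet_def by (rule prod.union_disjoint) auto
  also have "\<dots> = h"
    unfolding h_def prod.distrib by (subst (1 2) prod.reindex) (auto simp: inj_on_def)
  finally have h: "(\<Prod>t\<in>barred_alphabet k. geometric (x_var t)) = h" .
  show ?thesis
    unfolding prod schur_eq_tableau_sum sp_eq_king_sum
  proof (intro conjI has_sum_over_partitions)
    show "mvps_coeff (tableau_sum {1..k} (\<lambda>_ _. True) mvps_var (parts la)) e =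
      (if Poly_Mapping.keys e \<subseteq> {1..k}
       then of_nat (walks strip_kernel (\<lambda>_. 0) (Poly_Mapping.lookup e) k (parts la)) else 0)"
      if "is_partition la" for la e
      by (rule mvps_coeff_schur[OF parts_shape[OF that]])
    show "mvps_coeff (ss k la) e =
      (if Poly_Mapping.keys e \<subseteq> {1..k}
       then of_nat (walks osc_kernel (\<lambda>_. 0) (Poly_Mapping.lookup e) k (parts la)) else 0)"
      if "is_partition la" for la e
      by (rule mvps_coeff_ss[OF that assms])
  next
    fix g
    \<comment> \<open>The factor belonging to the start of the walks is 1, as the empty shape has
      exactly one filling (\<open>tableau_sum_zero\<close>).\<close>
    show "finite {a. walks strip_kernel (\<lambda>_. 0) g k a \<noteq> 0}"
      "{a. walks strip_kernel (\<lambda>_. 0) g k a \<noteq> 0} \<subseteq> shapes k"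
      "(\<Sum>a | walks strip_kernel (\<lambda>_. 0) g k a \<noteq> 0. of_nat (walks strip_kernel (\<lambda>_. 0) g k a) *
         tableau_sum (barred_alphabet k) (\<lambda>_ _. True) x_var a) = (\<Prod>i = 1..k. h $ g i)"
      using strip_kernel_walks(1,2)[OF fin] strip_kernel_walks(3)[OF fin, where v = x_var and g = g and j = k]
      by (simp_all add: h)
    show "finite {a. walks osc_kernel (\<lambda>_. 0) g k a \<noteq> 0}"
      "{a. walks osc_kernel (\<lambda>_. 0) g k a \<noteq> 0} \<subseteq> shapes k"
      "(\<Sum>a | walks osc_kernel (\<lambda>_. 0) g k a \<noteq> 0. of_nat (walks osc_kernel (\<lambda>_. 0) g k a) *
         king_sum k x_var a) = (\<Prod>i = 1..k. h $ g i)"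
      using osc_kernel_walks(1,2)[of x_var, OF x_var_inverse]
        osc_kernel_walks(3)[where v = x_var and g = g and k = k, OF x_var_inverse]
      by (simp_all add: h_def king_sum_def)
  qed
qed

end
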